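(* Let $2\le k\le n$, $\tfrac12<s<1$, and let $F_s$ and $F_s^\theta$ be the fractional $k$-Hessian operators associated with $f=\sigma_k^{1/k}$ as defined in the context. Let $\Omega\subset\mathbb{R}^n$ be open, and let $u:\mathbb{R}^n\to\mathbb{R}$ be convex, Lipschitz continuous with constant $L$, semi-concave with constant $SC$, and satisfy $$(1-s)F_s[u](x)\ge\eta_0>0,\qquad\forall x\in\Omega,$$ in the viscosity sense, for some constant $\eta_0>0$. Then there exists a positive constant $\theta$ depending only on $n$, $k$, $\eta_0$, $s$, $L$ and $SC$ such that $$F_s[u](x)=F_s^\theta[u](x),\qquad\forall x\in\Omega.$$ Furthermore, the result is stable as $s\to1$: for fixed $n,k,\eta_0,L,SC$, the constant $\theta$ can be chosen so that it does not go to $0$ as $s\to1$.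
   Context: $\sigma_j(\lambda)=\sum_{1\le i_1<\cdots<i_j\le n}\lambda_{i_1}\cdots\lambda_{i_j}$ and $\Gamma_k=\{\lambda\in\mathbb{R}^n:\sigma_j(\lambda)>0,\ j=1,\dots,k\}$. For a symmetric $n\times n$ matrix $A$ with eigenvalue vector $\lambda(A)\in\Gamma_k$, let $F(A)=\sigma_k^{1/k}(\lambda(A))$, $F^{ij}(A)=\partial F/\partial A_{ij}(A)$, and $$\mathcal{M}=\mathcal{M}_k=\{M=\{M^{ij}\}:\ \text{there is a symmetric } T \text{ with }\lambda(T)\in\Gamma_k\text{ and }M^{ij}=F^{ij}(T)\},$$ a set of positive definite symmetric matrices. With $\delta(u,x,y)=u(x+y)+u(x-y)-2u(x)$ and $\lambda_{\min}(M)$ the smallest eigenvalue of $M$, define $$F_s[u](x)=\inf_{M\in\mathcal{M}}\Big\{\frac12\int_{\mathbb{R}^n}\frac{\delta(u,x,y)}{|\sqrt{M}^{-1}y|^{n+2s}}\det\sqrt{M}^{-1}\,dy\Big\},$$ $$F_s^\theta[u](x)=\inf_{M\in\mathcal{M}}\Big\{\frac12\int_{\mathbb{R}^n}\frac{\delta(u,x,y)}{|\sqrt{M}^{-1}y|^{n+2s}}\det\sqrt{M}^{-1}\,dy\ \Big|\ \lambda_{\min}(M)\ge\theta\Big\}.$$ Semi-concave with constant $SC\ge0$ (on $\mathbb{R}^n$): $u$ is continuous and $\delta(u,x,y)\le SC|y|^2$ for all $x,y\in\mathbb{R}^n$ (equivalently $u-\frac{SC}{2}|x|^2$ is concave). Viscosity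 sense: $F_s[u]\ge g$ in $\Omega$ in the viscosity sense means that whenever $x\in\Omega$, $N$ is an open neighborhood of $x$ in $\Omega$, $\psi\in C^2(\overline N)$, $\psi(x)=u(x)$ and $\psi(y)>u(y)$ for all $y\in N\setminus\{x\}$, the function $v$ equal to $\psi$ in $N$ and to $u$ in $\mathbb{R}^n\setminus N$ satisfies $F_s[v](x)\ge g(x)$. *)

theory Defs
  imports "HOL-Analysis.Analysis"
begin

definition sigma :: "nat \<Rightarrow> real ^ 'n \<Rightarrow> real" where
  "sigma j l = (\<Sum>I | card I = j. \<Prod>i\<in>I. l $ i)"

definition Gamma_cone :: "nat \<Rightarrow> (real ^ 'n) set" where
  "Gamma_cone k = {l. \<forall>j\<in>{1..k}. sigma j l > 0}"

definition sym_mats :: "(real ^ 'n ^ 'n) set" where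
  "sym_mats = {A. transpose A = A}"

(* Eigenvalues counted with algebraic multiplicity; mat t is the scalar matrix t I. *)
definition is_eigval_vec :: "real ^ 'n ^ 'n \<Rightarrow> real ^ 'n \<Rightarrow> bool" where
  "is_eigval_vec A l \<longleftrightarrow> (\<forall>t. det (mat t - A) = (\<Prod>i\<in>UNIV. t - l $ i))"

(* For symmetric A the vector is determined up to a permutation of its entries;
   sigma and Gamma_cone do not depend on the ordering that is chosen. *)
definition eigval_vec :: "real ^ 'n ^ 'n \<Rightarrow> real ^ 'n" where
  "eigval_vec A = (SOME l. is_eigval_vec A l)"

definition lambda_min :: "real ^ 'n ^ 'n \<Rightarrow> real" where
  "lambda_min M = Min {c. \<exists>v. v \<noteq> 0 \<and> M *v v = c *\<^sub>R v}"

definition hess_F :: "nat \<Rightarrow> real ^ 'n ^ 'n \<Rightarrow> real" where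
  "hess_F k A = root k (sigma k (eigval_vec A))"

(* The matrix M = (F^ij(T)) of partial derivatives of F = hess_F k, a function on the
   symmetric matrices: as usual in the theory of fully nonlinear equations, M is the symmetric
   matrix for which the derivative of F at T in the symmetric direction H is
   (\<Sum>i j. M^ij H_ij), and M \<bullet> H is this sum. These conditions determine M. *)
definition is_F_gradient :: "nat \<Rightarrow> real ^ 'n ^ 'n \<Rightarrow> real ^ 'n ^ 'n \<Rightarrow> bool" where
  "is_F_gradient k T M \<longleftrightarrow>
     M \<in> sym_mats \<and> (hess_F k has_derivative (\<lambda>H. M \<bullet> H)) (at T within sym_mats)"

definition Mclass :: "nat \<Rightarrow> (real ^ 'n ^ 'n) set" where
  "Mclass k = {M. \<exists>T. T \<in> sym_mats \<and> eigval_vec T \<in> Gamma_cone k \<and> is_F_gradient k T M}"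

(* The positive semidefinite square root. *)
definition mat_sqrt :: "real ^ 'n ^ 'n \<Rightarrow> real ^ 'n ^ 'n" where
  "mat_sqrt M = (THE S. S \<in> sym_mats \<and> (\<forall>v. 0 \<le> v \<bullet> (S *v v)) \<and> S ** S = M)"

definition second_diff :: "('a::real_vector \<Rightarrow> real) \<Rightarrow> 'a \<Rightarrow> 'a \<Rightarrow> real" where
  "second_diff u x y = u (x + y) + u (x - y) - 2 * u x"

(* Integral with values in [-\<infinity>, \<infinity>], needed because a viscosity test function may grow at
   infinity. ennreal truncates negative reals to 0, so the two terms are the integrals of the
   positive and the negative part. The case \<infinity> - \<infinity> has no meaning; it does not arise when
   second_diff is nonnegative, as for convex u and test functions touching u from above. *)
definition ext_integral :: "'a measure \<Rightarrow> ('a \<Rightarrow> real) \<Rightarrow> ereal" where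
  "ext_integral \<mu> f =
     enn2ereal (\<integral>\<^sup>+ y. ennreal (f y) \<partial>\<mu>) - enn2ereal (\<integral>\<^sup>+ y. ennreal (- f y) \<partial>\<mu>)"

definition frac_lin :: "real \<Rightarrow> real ^ 'n ^ 'n \<Rightarrow> (real ^ 'n \<Rightarrow> real) \<Rightarrow> real ^ 'n \<Rightarrow> ereal" where
  "frac_lin s M u x =
     ereal (1 / 2) * ext_integral lborel
       (\<lambda>y. second_diff u x y / norm (matrix_inv (mat_sqrt M) *v y) powr (real CARD('n) + 2 * s)
            * det (matrix_inv (mat_sqrt M)))"

definition frac_hess :: "nat \<Rightarrow> real \<Rightarrow> (real ^ 'n \<Rightarrow> real) \<Rightarrow> real ^ 'n \<Rightarrow> ereal" where
  "frac_hess k s u x = (INF M\<in>Mclass k. frac_lin s M u x)"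

definition frac_hess_theta ::
    "nat \<Rightarrow> real \<Rightarrow> real \<Rightarrow> (real ^ 'n \<Rightarrow> real) \<Rightarrow> real ^ 'n \<Rightarrow> ereal" where
  "frac_hess_theta k s \<theta> u x = (INF M\<in>{M \<in> Mclass k. lambda_min M \<ge> \<theta>}. frac_lin s M u x)"

definition semi_concave :: "real \<Rightarrow> ('a::real_normed_vector \<Rightarrow> real) \<Rightarrow> bool" where
  "semi_concave C u \<longleftrightarrow>
     0 \<le> C \<and> continuous_on UNIV u \<and> (\<forall>x y. second_diff u x y \<le> C * (norm y)\<^sup>2)"

(* C^2 in the open set N with derivatives up to order two extending continuously to the closure;
   G is the gradient and H the Hessian. *)
definition C2_closure :: "(real ^ 'n) set \<Rightarrow> (real ^ 'n \<Rightarrow> real) \<Rightarrow> bool" where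
  "C2_closure N \<psi> \<longleftrightarrow>
     (\<exists>(G :: real ^ 'n \<Rightarrow> real ^ 'n) (H :: real ^ 'n \<Rightarrow> real ^ 'n ^ 'n).
        continuous_on (closure N) \<psi> \<and> continuous_on (closure N) G \<and> continuous_on (closure N) H \<and>
        (\<forall>y\<in>N. (\<psi> has_derivative (\<lambda>h. G y \<bullet> h)) (at y)) \<and>
        (\<forall>y\<in>N. (G has_derivative (\<lambda>h. H y *v h)) (at y)))"

(* Op[u] \<ge> g in \<Omega> in the viscosity sense, for a nonlocal operator Op. *)
definition viscosity_ge ::
    "((real ^ 'n \<Rightarrow> real) \<Rightarrow> real ^ 'n \<Rightarrow> ereal) \<Rightarrow> (real ^ 'n) set \<Rightarrow> (real ^ 'n \<Rightarrow> real) \<Rightarrow>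
     (real ^ 'n \<Rightarrow> real) \<Rightarrow> bool" where
  "viscosity_ge Op \<Omega> u g \<longleftrightarrow>
     (\<forall>x N \<psi>. x \<in> \<Omega> \<and> open N \<and> x \<in> N \<and> N \<subseteq> \<Omega> \<and> C2_closure N \<psi> \<and>
        \<psi> x = u x \<and> (\<forall>y\<in>N - {x}. u y < \<psi> y) \<longrightarrow>
        ereal (g x) \<le> Op (\<lambda>y. if y \<in> N then \<psi> y else u y) x)"

end

theory Submission
  imports Defs "HOL-Computational_Algebra.Fundamental_Theorem_Algebra"
begin

text \<open>
  After the substitution \<open>y = \<surd>M z\<close> the linear operators become
  \<open>L\<^sub>M u(x) = 1/2 \<integral> \<delta>(u, x, \<surd>M z) |z|\<^sup>-\<^sup>n\<^sup>-\<^sup>2\<^sup>s dz\<close>, and for convex \<open>u\<close> the integrand is an even convex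
  function of \<open>\<surd>M z\<close>, so \<open>L\<^sub>M u\<close> is monotone in the eigenvalues of \<open>M\<close> within a fixed eigenframe.
  Any \<open>k\<close> eigenvalues of \<open>M\<close> in the gradient class have product at least \<open>k\<^sup>-\<^sup>k\<close>; hence if the
  smallest one is tiny, at least \<open>n - k + 1\<close> of them, indexed by \<open>V\<close>, are large. In the same
  eigenframe the class contains a matrix \<open>M'\<close> with moderate eigenvalues on \<open>V\<close> and eigenvalues at
  most \<open>\<epsilon>\<close> off \<open>V\<close>. By convexity \<open>L\<^sub>M\<^sub>'\<close> is at most half of a part carried by \<open>V\<close>, which is dominated
  by \<open>L\<^sub>M\<close>, plus half of a part off \<open>V\<close>, which for small \<open>\<epsilon>\<close> is below \<open>\<eta>\<^sub>0 / (1 - s) \<le> L\<^sub>M\<^sub>'\<close> by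
  semi-concavity, the Lipschitz bound and the viscosity inequality. Hence \<open>L\<^sub>M\<^sub>' u(x) \<le> L\<^sub>M u(x)\<close>, and
  degenerate matrices can be dropped from the infimum. The factor \<open>1 - s\<close> cancels the blow-up of
  the kernel near the origin, so \<open>\<epsilon>\<close> can be chosen uniformly for \<open>s\<close> away from \<open>1/2\<close>.
\<close>

subsection \<open>Newton inequalities and elementary symmetric functions\<close>

text \<open>The gradient has the explicit eigenvalues sigma_(k-1)(l|i) / (k sigma_k(l)^((k-1)/k)),
  where l|i omits the index i. A product of Rayleigh inequalities bounds any \<open>k\<close> of
  them from below, and the powers of sigma_k cancel. Each Rayleigh inequality is Newton's inequality
  for the family without two indices, and Newton's inequality rests on the real-rootedness of prod
  (1 + l_i t) and of its derivatives. The obstacle is that two matrices can be compared only in a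
  common eigenframe, so no fixed M' can serve. It is built in the frame of M from the vector equal
  to 1 on V and to a large R elsewhere. Splitting the integral doubles the square roots of the
  eigenvalues, which is why 4 m' \<le> m is required on V. Half of the left side then reappears on
  the right; absorbing it requires it to be finite, which the quadratic and linear growth bounds
  give for 1/2 < s < 1. The viscosity inequality holds for u itself because a subgradient and
  semi-concavity provide a touching paraboloid at every point.\<close>

definition split_poly :: "real poly \<Rightarrow> bool" where
  "split_poly p \<longleftrightarrow> (\<exists>c rs. p = smult c (\<Prod>r\<leftarrow>rs. [:- r, 1:]))"

lemma poly_map_of_real: "poly (map_poly of_real p) (of_real x :: complex) = of_real (poly p x)"
  by (induction p) (auto simp: map_poly_pCons)

lemma map_poly_of_real_mult:
  "map_poly of_real (p * q) = (map_poly of_real p * map_poly of_real q :: complex poly)"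
  by (rule poly_eqI) (simp add: coeff_map_poly coeff_mult)

lemma poly_map_of_real_mult:
  "poly (map_poly of_real (p * q)) (z :: complex) =
     poly (map_poly of_real p) z * poly (map_poly of_real q) z"
  by (simp add: map_poly_of_real_mult)

text \<open>The fundamental theorem of algebra supplies a root; being real it splits off a real
  linear factor, and the quotient inherits the hypothesis. This criterion serves both derivatives
  and the generating polynomial of the elementary symmetric functions.\<close>

lemma complex_root_imp_real_root_imp_split:
  fixes p :: "real poly"
  assumes "\<And>z :: complex. poly (map_poly of_real p) z = 0 \<Longrightarrow> Im z = 0"
  shows "split_poly p"
  using assms
proof (induction "degree p" arbitrary: p rule: less_induct)
  case less
  show ?case
  proof (cases "degree p = 0")
    case True
    then obtain c where "p = [:c:]" by (metis degree_eq_zeroE)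
    then have "p = smult c (\<Prod>r\<leftarrow>[]. [:- r, 1:])" by simp
    then show ?thesis unfolding split_poly_def by blast
  next
    case False
    then have "\<not> constant (poly (map_poly of_real p :: complex poly))"
      by (simp add: constant_degree degree_map_poly)
    then obtain z :: complex where z: "poly (map_poly of_real p) z = 0"
      using fundamental_theorem_of_algebra by blast
    with less.prems have "Im z = 0" by blast
    then have "z = of_real (Re z)" by (simp add: complex_eq_iff)
    with z have "poly p (Re z) = 0" by (metis poly_map_of_real of_real_eq_0_iff)
    then obtain q where q: "p = [:- Re z, 1:] * q" by (auto simp: poly_eq_0_iff_dvd)
    with False have "q \<noteq> 0" by auto
    then have "degree p = Suc (degree q)" unfolding q
      by (subst degree_mult_eq) auto
    moreover have "Im w = 0" if "poly (map_poly of_real q) w = 0" for w :: complex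
      using less.prems[of w] that unfolding q poly_map_of_real_mult by simp
    ultimately have "split_poly q" using less.hyps by simp
    then obtain c rs where "q = smult c (\<Prod>r\<leftarrow>rs. [:- r, 1:])"
      unfolding split_poly_def by blast
    then have "p = smult c (\<Prod>r\<leftarrow>Re z # rs. [:- r, 1:])" using q by simp
    then show ?thesis unfolding split_poly_def by blast
  qed
qed

text \<open>P'/P is the sum of the terms 1/(z - r), and each has imaginary part of sign opposite to
  Im z. The factor Im z treats both half-planes at once. This is the Gauss-Lucas argument.\<close>

lemma Im_logderiv:
  fixes rs :: "real list" and z :: complex
  assumes "Im z \<noteq> 0"
  defines "P \<equiv> (\<Prod>r\<leftarrow>rs. [:- of_real r, 1:] :: complex poly)"
  shows "poly P z \<noteq> 0 \<and> Im z * Im (poly (pderiv P) z / poly P z) \<le> 0 \<and>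
    (rs \<noteq> [] \<longrightarrow> Im z * Im (poly (pderiv P) z / poly P z) < 0)"
  unfolding P_def
proof (induction rs)
  case (Cons r rs)
  let ?Q = "(\<Prod>r\<leftarrow>rs. [:- of_real r, 1:] :: complex poly)"
  have nz: "z - of_real r \<noteq> 0" using assms by (auto simp: complex_eq_iff)
  have "Im (1 / (z - of_real r)) = - Im z / (cmod (z - of_real r))\<^sup>2"
    by (simp add: Im_divide cmod_power2)
  then have 1: "Im z * Im (1 / (z - of_real r)) < 0"
    using nz assms by (simp add: power2_eq_square[symmetric] zero_less_mult_iff divide_less_0_iff)
  have "(a + w * b) / (w * a) = 1 / w + b / a" if "w \<noteq> 0" "a \<noteq> 0" for a b w :: complex
    using that by (simp add: field_simps)
  from this[of "z - of_real r" "poly ?Q z" "poly (pderiv ?Q) z"]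
  have "(poly ?Q z + (z - of_real r) * poly (pderiv ?Q) z) / ((z - of_real r) * poly ?Q z)
     = 1 / (z - of_real r) + poly (pderiv ?Q) z / poly ?Q z"
    using nz Cons by blast
  moreover have "poly (pderiv ([:- of_real r, 1:] * ?Q)) z = poly ?Q z + (z - of_real r) * poly (pderiv ?Q) z"
    by (simp add: pderiv_mult pderiv_pCons del: mult_pCons_left)
  moreover have "poly ([:- of_real r, 1:] * ?Q) z = (z - of_real r) * poly ?Q z"
    by (simp del: mult_pCons_left)
  ultimately have "poly (pderiv ([:- of_real r, 1:] * ?Q)) z / poly ([:- of_real r, 1:] * ?Q) z
     = 1 / (z - of_real r) + poly (pderiv ?Q) z / poly ?Q z"
    by (simp only:)
  then have "Im z * Im (poly (pderiv ([:- of_real r, 1:] * ?Q)) z / poly ([:- of_real r, 1:] * ?Q) z)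
     = Im z * Im (1 / (z - of_real r)) + Im z * Im (poly (pderiv ?Q) z / poly ?Q z)"
    by (simp add: distrib_left del: mult_pCons_left)
  with 1 Cons have "Im z * Im (poly (pderiv ([:- of_real r, 1:] * ?Q)) z / poly ([:- of_real r, 1:] * ?Q) z) < 0"
    by linarith
  moreover have "poly ([:- of_real r, 1:] * ?Q) z \<noteq> 0" using Cons nz by simp
  ultimately show ?case by (simp del: mult_pCons_left)
qed simp

lemma map_poly_prod_list:
  "map_poly of_real (\<Prod>r\<leftarrow>rs. [:- r, 1:]) = (\<Prod>r\<leftarrow>rs. [:- of_real r, 1:] :: complex poly)"
  by (induction rs)
     (simp_all add: map_poly_of_real_mult map_poly_pCons del: mult_pCons_left mult_pCons_right)

text \<open>A nonreal zero of P' would be a zero of P'/P, which \<open>Im_logderiv\<close> excludes.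
  Unlike an argument by Rolle's theorem, this needs no count of multiplicities.\<close>

lemma split_poly_pderiv:
  assumes "split_poly p"
  shows "split_poly (pderiv p)"
proof -
  obtain c rs where p: "p = smult c (\<Prod>r\<leftarrow>rs. [:- r, 1:])"
    using assms unfolding split_poly_def by blast
  show ?thesis
  proof (cases "c = 0 \<or> rs = []")
    case True
    then have "pderiv p = smult 0 (\<Prod>r\<leftarrow>[]. [:- r, 1:])" using p by (auto simp: pderiv_smult)
    then show ?thesis unfolding split_poly_def by blast
  next
    case False
    show ?thesis
    proof (rule complex_root_imp_real_root_imp_split, rule ccontr)
      fix z :: complex
      assume z: "poly (map_poly of_real (pderiv p)) z = 0" and im: "Im z \<noteq> 0"
      let ?P = "(\<Prod>r\<leftarrow>rs. [:- of_real r, 1:] :: complex poly)"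
      have "map_poly of_real (pderiv p) = smult (of_real c) (pderiv ?P)"
        unfolding p pderiv_smult map_poly_prod_list[symmetric]
        by (rule poly_eqI) (simp add: coeff_map_poly coeff_pderiv)
      then have "poly (pderiv ?P) z = 0" using z False by simp
      then show False using Im_logderiv[OF im, of rs] False by simp
    qed
  qed
qed

text \<open>Away from the roots, (P')^2 - P P'' equals P^2 times the sum of 1/(x - r)^2. The
  induction over the roots proves the same without dividing.\<close>

lemma Laguerre_ineq:
  assumes "split_poly p"
  shows "poly p x * poly (pderiv (pderiv p)) x \<le> (poly (pderiv p) x)\<^sup>2"
proof -
  obtain c rs where p: "p = smult c (\<Prod>r\<leftarrow>rs. [:- r, 1:])"
    using assms unfolding split_poly_def by blast
  let ?P = "\<lambda>rs. (\<Prod>r\<leftarrow>rs. [:- r, 1:] :: real poly)"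
  have *: "poly (?P rs) x * poly (pderiv (pderiv (?P rs))) x \<le> (poly (pderiv (?P rs)) x)\<^sup>2"
  proof (induction rs)
    case (Cons r rs)
    let ?q = "?P rs"
    have d: "pderiv ([:- r, 1:] * q) = q + [:- r, 1:] * pderiv q" for q
      by (simp add: pderiv_mult pderiv_pCons del: mult_pCons_left)
    have "(poly (pderiv ([:- r, 1:] * ?q)) x)\<^sup>2 -
        poly ([:- r, 1:] * ?q) x * poly (pderiv (pderiv ([:- r, 1:] * ?q))) x
      = (poly ?q x)\<^sup>2 + (x - r)\<^sup>2 * ((poly (pderiv ?q) x)\<^sup>2 - poly ?q x * poly (pderiv (pderiv ?q)) x)"
      by (simp add: d pderiv_add del: mult_pCons_left) (simp add: algebra_simps power2_eq_square)
    also have "\<dots> \<ge> 0" using Cons by simp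
    finally show ?case by simp
  qed simp
  have "c\<^sup>2 * (poly (?P rs) x * poly (pderiv (pderiv (?P rs))) x) \<le> c\<^sup>2 * (poly (pderiv (?P rs)) x)\<^sup>2"
    by (rule mult_left_mono[OF *]) simp
  then show ?thesis unfolding p by (simp add: pderiv_smult power2_eq_square algebra_simps)
qed

text \<open>Laguerre's inequality at 0 for the j-th derivative, which still splits, gives (j+2) c_j
  c_(j+2) \<le> (j+1) c_(j+1)^2. The sharper binomial weights of Newton's inequality are given
  up.\<close>

lemma split_poly_Newton:
  assumes "split_poly p"
  shows "coeff p j * coeff p (j + 2) \<le> (coeff p (j + 1))\<^sup>2"
proof -
  have "split_poly ((pderiv ^^ j) p)"
    by (induction j) (auto simp: assms split_poly_pderiv)
  from Laguerre_ineq[OF this, of 0]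
  have "coeff ((pderiv ^^ j) p) 0 * (2 * coeff ((pderiv ^^ j) p) 2) \<le> (coeff ((pderiv ^^ j) p) 1)\<^sup>2"
    by (simp add: poly_0_coeff_0 coeff_pderiv numeral_2_eq_2)
  moreover have "fact i * pochhammer (real (Suc i)) j = fact (i + j)" for i
  proof (induction j)
    case (Suc j)
    have "fact i * pochhammer (real (Suc i)) (Suc j) =
        (fact i * pochhammer (real (Suc i)) j) * (real (Suc i) + real j)"
      by (simp add: pochhammer_Suc mult.assoc)
    also have "\<dots> = fact (i + Suc j)"
      unfolding Suc by (simp add: algebra_simps)
    finally show ?case .
  qed simp
  from this[of 0] this[of 1] this[of 2]
  have "pochhammer 1 j = (fact j :: real)" "pochhammer 2 j = (fact (j + 1) :: real)"
    "2 * pochhammer 3 j = (fact (j + 2) :: real)"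
    by (simp_all add: numeral_2_eq_2 numeral_3_eq_3 add.commute)
  then have "coeff ((pderiv ^^ j) p) 0 = fact j * coeff p j"
    "coeff ((pderiv ^^ j) p) 1 = fact (j + 1) * coeff p (j + 1)"
    "2 * coeff ((pderiv ^^ j) p) 2 = fact (j + 2) * coeff p (j + 2)"
    by (simp_all add: coeff_higher_pderiv add.commute)
  ultimately have "fact j * coeff p j * (fact (j + 2) * coeff p (j + 2)) \<le> (fact (j + 1) * coeff p (j + 1))\<^sup>2"
    by simp
  then have "(fact j * fact (j + 1)) * (real (j + 2) * (coeff p j * coeff p (j + 2))) \<le>
      (fact j * fact (j + 1)) * (real (j + 1) * (coeff p (j + 1))\<^sup>2)"
    by (simp add: power2_eq_square algebra_simps)
  then have le: "real (j + 2) * (coeff p j * coeff p (j + 2)) \<le> real (j + 1) * (coeff p (j + 1))\<^sup>2"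
    by (rule mult_left_le_imp_le) simp
  show ?thesis
  proof (cases "coeff p j * coeff p (j + 2) \<le> 0")
    case True
    then show ?thesis by (meson order_trans zero_le_power2)
  next
    case False
    then have "real (j + 1) * (coeff p j * coeff p (j + 2)) \<le> real (j + 2) * (coeff p j * coeff p (j + 2))"
      by (intro mult_right_mono) auto
    with le have "real (j + 1) * (coeff p j * coeff p (j + 2)) \<le> real (j + 1) * (coeff p (j + 1))\<^sup>2"
      by linarith
    then show ?thesis by (rule mult_left_le_imp_le) simp
  qed
qed

text \<open>As coefficients of prod (1 + l_i t), these functions get their recursion from polynomial
  multiplication and Newton's inequality from real-rootedness. The index set is an argument because
  \<open>esym l (I - {i}) j\<close> is the partial derivative of the next function with respect to
  l_i.\<close>

definition esym :: "('i \<Rightarrow> real) \<Rightarrow> 'i set \<Rightarrow> nat \<Rightarrow> real" where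
  "esym l I j = coeff (\<Prod>i\<in>I. [:1, l i:]) j"

lemma esym_0 [simp]: "esym l I 0 = 1"
  by (simp add: esym_def poly_0_coeff_0[symmetric] poly_prod)

lemma esym_empty [simp]: "esym l {} (Suc j) = 0"
  by (simp add: esym_def)

lemma esym_insert:
  assumes "finite I" "i \<notin> I"
  shows "esym l (insert i I) (Suc j) = esym l I (Suc j) + l i * esym l I j"
  using assms by (simp add: esym_def)

lemma esym_remove:
  assumes "finite I" "i \<in> I"
  shows "esym l I (Suc j) = esym l (I - {i}) (Suc j) + l i * esym l (I - {i}) j"
  using esym_insert[of "I - {i}" i l j] assms by (simp add: insert_absorb)

lemma esym_eq_sum:
  assumes "finite I"
  shows "esym l I j = (\<Sum>K | K \<subseteq> I \<and> card K = j. \<Prod>i\<in>K. l i)"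
  using assms
proof (induction I arbitrary: j rule: finite_induct)
  case empty
  show ?case
  proof (cases j)
    case 0
    have "{K::'a set. K \<subseteq> {} \<and> card K = 0} = {{}}" by auto
    with 0 show ?thesis by simp
  next
    case (Suc m)
    have "{K::'a set. K \<subseteq> {} \<and> card K = Suc m} = {}" by auto
    with Suc show ?thesis by (simp only: sum.empty esym_empty)
  qed
next
  case (insert x I)
  show ?case
  proof (cases j)
    case 0
    have "{K. K \<subseteq> insert x I \<and> card K = 0} = {{}}"
      using insert.hyps finite_subset by fastforce
    with 0 show ?thesis by simp
  next
    case (Suc m)
    have fin: "finite {K. K \<subseteq> I \<and> card K = i}" for i
      using insert.hyps by (auto intro: finite_subset[of _ "Pow I"])
    have "{K. K \<subseteq> insert x I \<and> card K = Suc m} =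
      {K. K \<subseteq> I \<and> card K = Suc m} \<union> insert x ` {K. K \<subseteq> I \<and> card K = m}" (is "?A = ?B \<union> ?C")
    proof (intro equalityI subsetI)
      fix K assume K: "K \<in> ?A"
      show "K \<in> ?B \<union> ?C"
      proof (cases "x \<in> K")
        case True
        then have "K = insert x (K - {x})" by auto
        moreover have "K - {x} \<in> {K. K \<subseteq> I \<and> card K = m}" using K True by auto
        ultimately show ?thesis by blast
      next
        case False
        then show ?thesis using K by blast
      qed
    next
      fix K assume "K \<in> ?B \<union> ?C"
      then consider "K \<in> ?B" | K' where "K = insert x K'" "K' \<subseteq> I" "card K' = m" by blast
      then show "K \<in> ?A"
      proof cases
        case 2
        then have "finite K'" "x \<notin> K'" using insert.hyps finite_subset by blast+
        then show ?thesis using 2 by auto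
      qed auto
    qed
    then have "(\<Sum>K | K \<subseteq> insert x I \<and> card K = Suc m. \<Prod>i\<in>K. l i) =
      (\<Sum>K | K \<subseteq> I \<and> card K = Suc m. \<Prod>i\<in>K. l i) +
      (\<Sum>K\<in>insert x ` {K. K \<subseteq> I \<and> card K = m}. \<Prod>i\<in>K. l i)"
      using insert.hyps fin by (subst sum.union_disjoint[symmetric]) auto
    also have "(\<Sum>K\<in>insert x ` {K. K \<subseteq> I \<and> card K = m}. \<Prod>i\<in>K. l i) =
      (\<Sum>K | K \<subseteq> I \<and> card K = m. \<Prod>i\<in>insert x K. l i)"
      using insert.hyps
      by (subst sum.reindex) (auto simp: inj_on_def intro: insert_eq_iff[THEN iffD1])
    also have "\<dots> = (\<Sum>K | K \<subseteq> I \<and> card K = m. l x * (\<Prod>i\<in>K. l i))"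
      using insert.hyps finite_subset by (intro sum.cong refl prod.insert) auto
    finally show ?thesis
      using insert Suc by (simp add: esym_insert sum_distrib_left)
  qed
qed

lemma sigma_eq_esym: "sigma j l = esym (\<lambda>i. l $ i) UNIV j"
  by (simp add: sigma_def esym_eq_sum)

lemma esym_Newton:
  assumes "finite I"
  shows "esym l I j * esym l I (j + 2) \<le> (esym l I (j + 1))\<^sup>2"
  unfolding esym_def
proof (rule split_poly_Newton[OF complex_root_imp_real_root_imp_split])
  fix z :: complex
  have "map_poly of_real (\<Prod>i\<in>I. [:1, l i:]) = (\<Prod>i\<in>I. [:1, of_real (l i):] :: complex poly)"
    using assms by (induction I rule: finite_induct)
     (simp_all add: map_poly_of_real_mult map_poly_pCons del: mult_pCons_left mult_pCons_right)
  moreover assume "poly (map_poly of_real (\<Prod>i\<in>I. [:1, l i:])) z = 0"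
  ultimately obtain i where "1 + z * of_real (l i) = 0"
    using assms by (auto simp: poly_prod)
  then show "Im z = 0" by (auto simp: complex_eq_iff)
qed

definition in_Gamma :: "nat \<Rightarrow> ('i \<Rightarrow> real) \<Rightarrow> 'i set \<Rightarrow> bool" where
  "in_Gamma k l I \<longleftrightarrow> (\<forall>j\<le>k. 0 < esym l I j)"

text \<open>Let e_j be the functions of the family without i, with e_j > 0. If e_(j+1) were
  nonpositive, positivity of the next two functions of the full family would force l_i > 0 and e_j
  e_(j+2) > e_(j+1)^2, against Newton's inequality.\<close>

lemma in_Gamma_remove:
  assumes "finite I" "i \<in> I" "in_Gamma (Suc k) l I"
  shows "in_Gamma k l (I - {i})"
proof -
  have "0 < esym l (I - {i}) j" if "j \<le> k" for j
    using that
  proof (induction j)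
    case (Suc j)
    let ?e = "esym l (I - {i})"
    have e: "esym l I (Suc m) = ?e (Suc m) + l i * ?e m" for m
      by (rule esym_remove) fact+
    have pos: "0 < ?e j" using Suc by simp
    have p: "0 < ?e (Suc j) + l i * ?e j" "0 < ?e (Suc (Suc j)) + l i * ?e (Suc j)"
      using assms(3) Suc.prems unfolding in_Gamma_def e[symmetric] by auto
    show ?case
    proof (rule ccontr)
      assume "\<not> 0 < ?e (Suc j)"
      then have le: "?e (Suc j) \<le> 0" by simp
      with p(1) have "0 < l i * ?e j" by linarith
      then have li: "0 < l i" using pos by (simp add: zero_less_mult_iff)
      have "l i * (- ?e (Suc j)) < ?e (Suc (Suc j))" using p(2) by simp
      then have "?e j * (l i * (- ?e (Suc j))) < ?e j * ?e (Suc (Suc j))"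
        using pos by (rule mult_strict_left_mono)
      also have "\<dots> \<le> (?e (Suc j))\<^sup>2"
        using esym_Newton[of "I - {i}" l j] assms(1) by simp
      also have "\<dots> = (- ?e (Suc j)) * (- ?e (Suc j))" by (simp add: power2_eq_square)
      also have "\<dots> \<le> (l i * ?e j) * (- ?e (Suc j))"
        using p(1) le by (intro mult_right_mono) auto
      finally show False by (simp add: mult_ac)
    qed
  qed simp
  then show ?thesis by (simp add: in_Gamma_def)
qed

text \<open>Expanding in l_i and l_j, everything cancels in the difference of the two sides except
  e_(k+1)^2 - e_k e_(k+2) for the family without i and j.\<close>

lemma esym_Rayleigh:
  assumes "finite I" "i \<in> I" "j \<in> I" "i \<noteq> j"
  shows "esym l I (Suc (Suc k)) * esym l (I - {i} - {j}) k \<le>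
    esym l (I - {i}) (Suc k) * esym l (I - {j}) (Suc k)"
proof -
  let ?e = "esym l (I - {i} - {j})"
  have 1: "esym l (I - {i}) (Suc m) = ?e (Suc m) + l j * ?e m" for m
    using assms by (intro esym_remove) auto
  have eq: "I - {i} - {j} = I - {j} - {i}" by auto
  have 2: "esym l (I - {j}) (Suc m) = ?e (Suc m) + l i * ?e m" for m
    unfolding eq using assms by (intro esym_remove) auto
  have 3: "esym l I (Suc m) = esym l (I - {i}) (Suc m) + l i * esym l (I - {i}) m" for m
    using assms by (intro esym_remove) auto
  have "?e k * ?e (k + 2) \<le> (?e (k + 1))\<^sup>2"
    using assms by (intro esym_Newton) auto
  then show ?thesis
    by (simp add: 1 2 3 algebra_simps power2_eq_square)
qed

text \<open>The induction step multiplies the Rayleigh inequalities for the pairs \<open>(i, j)\<close>, \<open>i \<in> J - {j}\<close>.\<close>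

lemma prod_esym_remove_ge:
  assumes "finite I" "in_Gamma k l I" "J \<subseteq> I" "card J = k" "1 \<le> k"
  shows "esym l I k ^ (k - 1) \<le> (\<Prod>i\<in>J. esym l (I - {i}) (k - 1))"
  using assms
proof (induction k arbitrary: I J)
  case (Suc k)
  show ?case
  proof (cases "k = 0")
    case False
    then obtain m where m: "k = Suc m" by (cases k) auto
    have finJ: "finite J" using Suc.prems finite_subset by blast
    obtain j where j: "j \<in> J" using Suc.prems by (cases "J = {}") auto
    let ?J = "J - {j}" and ?I = "I - {j}"
    let ?a = "esym l I (Suc k)" and ?b = "esym l ?I k"
    have G: "in_Gamma k l ?I" using Suc.prems j by (intro in_Gamma_remove) auto
    have b: "0 < ?b" using G by (simp add: in_Gamma_def)
    have a: "0 < ?a" using Suc.prems by (simp add: in_Gamma_def)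
    have cJ: "card ?J = k" using Suc.prems j finJ by simp
    have IH: "?b ^ (k - 1) \<le> (\<Prod>i\<in>?J. esym l (?I - {i}) (k - 1))"
      using Suc.prems False G cJ by (intro Suc.IH) auto
    have pos: "0 < esym l (I - {i}) k" if "i \<in> J" for i
      using in_Gamma_remove[of I i k l] Suc.prems that by (auto simp: in_Gamma_def)
    have "?a ^ k * ?b ^ (k - 1) \<le> ?a ^ k * (\<Prod>i\<in>?J. esym l (?I - {i}) (k - 1))"
      using a IH by (intro mult_left_mono) auto
    also have "\<dots> = (\<Prod>i\<in>?J. ?a * esym l (?I - {i}) (k - 1))"
      by (simp add: prod.distrib cJ)
    also have "\<dots> \<le> (\<Prod>i\<in>?J. esym l (I - {i}) k * ?b)"
    proof (rule prod_mono, intro conjI)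
      fix i assume i: "i \<in> ?J"
      have "in_Gamma m l (?I - {i})"
        using G i Suc.prems m by (intro in_Gamma_remove[of ?I i m l]) auto
      then show "0 \<le> ?a * esym l (?I - {i}) (k - 1)"
        using a m by (auto simp: in_Gamma_def less_imp_le)
      have "?I - {i} = I - {i} - {j}" by auto
      then show "?a * esym l (?I - {i}) (k - 1) \<le> esym l (I - {i}) k * ?b"
        using esym_Rayleigh[of I i j l m] Suc.prems i j m by (auto simp: subset_iff)
    qed
    also have "\<dots> = (\<Prod>i\<in>?J. esym l (I - {i}) k) * ?b ^ k"
      by (simp add: prod.distrib cJ)
    \<comment> \<open>One of the \<open>k\<close> factors \<open>?b\<close> is itself the factor of
      index j in the product over J. The remaining \<open>k - 1\<close> cancel against the left
      side.\<close>
    also have "\<dots> = (\<Prod>i\<in>J. esym l (I - {i}) k) * ?b ^ (k - 1)"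
      using prod.remove[OF finJ j, of "\<lambda>i. esym l (I - {i}) k"] m by simp
    finally show ?thesis using b by simp
  qed (use Suc.prems in simp)
qed simp

subsection \<open>Spectral theorem for real symmetric matrices\<close>

definition diag :: "real ^ 'n \<Rightarrow> real ^ 'n ^ 'n" where
  "diag l = (\<chi> i j. if i = j then l $ i else 0)"

lemma diag_component [simp]: "diag l $ i $ j = (if i = j then l $ i else 0)"
  by (simp add: diag_def)

lemma diag_vector: "diag l *v x = l * x"
  by (simp add: vec_eq_iff matrix_vector_mult_def if_distrib[of "\<lambda>a. a * _"] cong: if_cong)

lemma diag_mult_diag: "diag a ** diag b = diag (a * b)"
  by (simp add: vec_eq_iff matrix_matrix_mult_def if_distrib[of "\<lambda>a. a * _"] cong: if_cong)

lemma transpose_diag [simp]: "transpose (diag l) = diag l"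
  by (simp add: vec_eq_iff transpose_def)

lemma diag_one: "diag 1 = mat 1"
  by (simp add: vec_eq_iff mat_def)

lemma det_diag: "det (diag l) = (\<Prod>i\<in>UNIV. l $ i)"
  by (subst det_diagonal) auto

abbreviation conjm :: "real ^ 'n ^ 'n \<Rightarrow> real ^ 'n ^ 'n \<Rightarrow> real ^ 'n ^ 'n" where
  "conjm Q A \<equiv> Q ** A ** transpose Q"

lemma orthogonal_matrix_mult_cancel:
  fixes Q :: "real ^ 'n ^ 'n"
  assumes "orthogonal_matrix Q"
  shows "transpose Q ** Q = mat 1" "Q ** transpose Q = mat 1"
    "transpose Q ** (Q ** A) = A" "Q ** (transpose Q ** A) = A"
    "transpose Q *v (Q *v x) = x" "Q *v (transpose Q *v x) = x"
proof -
  show 1: "transpose Q ** Q = mat 1" and 2: "Q ** transpose Q = mat 1"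
    using assms by (auto simp: orthogonal_matrix_def)
  show "transpose Q ** (Q ** A) = A" "Q ** (transpose Q ** A) = A"
    by (simp_all add: matrix_mul_assoc 1 2)
  show "transpose Q *v (Q *v x) = x" "Q *v (transpose Q *v x) = x"
    by (simp_all only: matrix_vector_mul_assoc 1 2 matrix_vector_mul_lid)
qed

lemma conjm_mult:
  assumes "orthogonal_matrix Q"
  shows "conjm Q A ** conjm Q B = conjm Q (A ** B)"
  by (simp add: matrix_mul_assoc[symmetric] orthogonal_matrix_mult_cancel[OF assms])

lemma transpose_conjm: "transpose (conjm Q A) = conjm Q (transpose A)"
  by (simp add: matrix_transpose_mul matrix_mul_assoc)

text \<open>The inner product is the trace form, so conjugation by the transpose is the adjoint. It
  turns a derivative in a rotated direction into entries of the gradient in the eigenframe.\<close>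

lemma inner_conjm:
  fixes M Q :: "real ^ 'n ^ 'n"
  shows "M \<bullet> conjm Q H = conjm (transpose Q) M \<bullet> H"
proof -
  have 1: "A \<bullet> (P ** B) = (transpose P ** A) \<bullet> B" for A P B :: "real ^ 'n ^ 'n"
  proof -
    have "A \<bullet> (P ** B) = (\<Sum>i\<in>UNIV. \<Sum>j\<in>UNIV. \<Sum>k\<in>UNIV. A $ i $ j * (P $ i $ k * B $ k $ j))"
      by (simp add: inner_vec_def matrix_matrix_mult_def sum_distrib_left)
    also have "\<dots> = (\<Sum>i\<in>UNIV. \<Sum>k\<in>UNIV. \<Sum>j\<in>UNIV. A $ i $ j * (P $ i $ k * B $ k $ j))"
      by (intro sum.cong refl sum.swap)
    also have "\<dots> = (\<Sum>k\<in>UNIV. \<Sum>i\<in>UNIV. \<Sum>j\<in>UNIV. A $ i $ j * (P $ i $ k * B $ k $ j))"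
      by (rule sum.swap)
    also have "\<dots> = (\<Sum>k\<in>UNIV. \<Sum>j\<in>UNIV. \<Sum>i\<in>UNIV. A $ i $ j * (P $ i $ k * B $ k $ j))"
      by (intro sum.cong refl sum.swap)
    also have "\<dots> = (transpose P ** A) \<bullet> B"
      by (simp add: inner_vec_def matrix_matrix_mult_def transpose_def sum_distrib_left
        inner_commute mult_ac)
    finally show ?thesis .
  qed
  have tr: "A \<bullet> B = transpose A \<bullet> transpose B" for A B :: "real ^ 'n ^ 'n"
    by (simp add: inner_vec_def transpose_def) (rule sum.swap)
  have 2: "A \<bullet> (B ** P) = (A ** transpose P) \<bullet> B" for A P B :: "real ^ 'n ^ 'n"
    by (subst tr, subst matrix_transpose_mul, subst 1, subst tr) (simp add: matrix_transpose_mul)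
  have "M \<bullet> conjm Q H = (M ** Q) \<bullet> (Q ** H)" by (simp add: 2)
  also have "\<dots> = (transpose Q ** (M ** Q)) \<bullet> H" by (rule 1)
  finally show ?thesis by (simp add: matrix_mul_assoc)
qed

text \<open>A maximizer of the quadratic form on the unit sphere of S is an eigenvector, and its
  orthogonal complement in S is again invariant. The statement is about invariant subspaces so that
  this complement can be fed to the induction.\<close>

lemma symmetric_eigenbasis:
  fixes f :: "'a::euclidean_space \<Rightarrow> 'a"
  assumes lin: "linear f" and sym: "\<And>x y. f x \<bullet> y = x \<bullet> f y"
    and "subspace S" and "f ` S \<subseteq> S"
  shows "\<exists>B. B \<subseteq> S \<and> pairwise orthogonal B \<and> (\<forall>b\<in>B. norm b = 1 \<and> (\<exists>c. f b = c *\<^sub>R b)) \<and>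
    card B = dim S \<and> finite B"
  using assms(3,4)
proof (induction "dim S" arbitrary: S)
  case 0
  then show ?case by (intro exI[of _ "{}"]) auto
next
  case (Suc d)
  let ?K = "S \<inter> sphere 0 1"
  have "compact ?K"
    using Suc.prems closed_subspace by (intro closed_Int_compact) auto
  moreover have "?K \<noteq> {}"
  proof -
    obtain v where "v \<in> S" "v \<noteq> 0" using Suc.hyps(2) Suc.prems
      by (metis dim_eq_0 subset_singleton_iff singletonI subsetI nat.distinct(1) insert_iff)
    then have "v /\<^sub>R norm v \<in> ?K" using Suc.prems(1) by (auto simp: subspace_scale)
    then show ?thesis by blast
  qed
  moreover have cont: "continuous_on ?K (\<lambda>v. v \<bullet> f v)"
    using lin by (intro continuous_intros linear_continuous_on linear_linear[THEN iffD1])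
      (simp add: linear_conv_bounded_linear)
  ultimately obtain v where "v \<in> ?K" and vmax: "\<forall>w\<in>?K. w \<bullet> f w \<le> v \<bullet> f v"
    using continuous_attains_sup[of ?K "\<lambda>v. v \<bullet> f v"] by blast
  then have v: "v \<in> S" "norm v = 1" by auto
  have max: "w \<bullet> f w \<le> v \<bullet> f v" if "w \<in> S" "norm w = 1" for w
    using vmax that by simp
  let ?c = "v \<bullet> f v"
  have max': "w \<bullet> f w \<le> ?c * (w \<bullet> w)" if "w \<in> S" for w
  proof (cases "w = 0")
    case False
    have "(w /\<^sub>R norm w) \<bullet> f (w /\<^sub>R norm w) \<le> ?c"
      using False that Suc.prems(1) by (intro max) (auto simp: subspace_scale)
    then have "(w \<bullet> f w) / (norm w)\<^sup>2 \<le> ?c"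
      by (simp add: linear_scale[OF lin] power2_eq_square field_simps)
    then show ?thesis using False by (simp add: field_simps power2_norm_eq_inner)
  qed (simp add: linear_0[OF lin])
  let ?w = "f v - ?c *\<^sub>R v"
  have wS: "?w \<in> S" using Suc.prems v by (auto intro!: subspace_diff subspace_scale)
  have vw: "v \<bullet> ?w = 0"
    using v by (simp add: inner_diff_right power2_norm_eq_inner[symmetric])
  have fvw: "f v \<bullet> ?w = ?w \<bullet> ?w" using vw by (simp add: inner_diff_left)
  have "?w = 0"
  proof (rule ccontr)
    assume nz: "?w \<noteq> 0"
    \<comment> \<open>If the residual w = f v - c v were nonzero, moving v by t w would raise the
      quadratic form by 2 t |w|^2 to first order. This t is small enough for the second-order term
      to absorb at most half of the gain, and the summand 1 keeps \<open>?D\<close>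
      positive.\<close>
    let ?D = "\<bar>?w \<bullet> f ?w - ?c * (?w \<bullet> ?w)\<bar> + 1"
    define t where "t = (?w \<bullet> ?w) / ?D"
    have ww: "0 < ?w \<bullet> ?w" using nz by simp
    have D: "0 < ?D" by linarith
    have t: "0 < t" unfolding t_def using ww D by simp
    have "(v + t *\<^sub>R ?w) \<bullet> f (v + t *\<^sub>R ?w) \<le> ?c * ((v + t *\<^sub>R ?w) \<bullet> (v + t *\<^sub>R ?w))"
      using v wS Suc.prems(1) by (intro max') (auto intro!: subspace_add subspace_scale)
    moreover have "(v + t *\<^sub>R ?w) \<bullet> f (v + t *\<^sub>R ?w) = ?c + 2 * t * (?w \<bullet> ?w) + t\<^sup>2 * (?w \<bullet> f ?w)"
    proof -
      have "(v + t *\<^sub>R ?w) \<bullet> f (v + t *\<^sub>R ?w) =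
        v \<bullet> f v + t * (v \<bullet> f ?w) + t * (?w \<bullet> f v) + t * t * (?w \<bullet> f ?w)"
        unfolding linear_add[OF lin] linear_scale[OF lin]
        by (simp only: inner_add_left inner_add_right inner_scaleR_left inner_scaleR_right distrib_left mult.assoc add.assoc)
      moreover have "v \<bullet> f ?w = ?w \<bullet> ?w" using sym[of v ?w] fvw by simp
      moreover have "?w \<bullet> f v = ?w \<bullet> ?w" using fvw by (simp only: inner_commute)
      ultimately show ?thesis by (simp only: power2_eq_square)
    qed
    moreover have "(v + t *\<^sub>R ?w) \<bullet> (v + t *\<^sub>R ?w) = 1 + t\<^sup>2 * (?w \<bullet> ?w)"
    proof -
      have "v \<bullet> v = 1" using v by (simp add: power2_norm_eq_inner[symmetric])
      moreover have "?w \<bullet> v = 0" using vw by (simp only: inner_commute)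
      ultimately show ?thesis using vw
        by (simp only: inner_add_left inner_add_right inner_scaleR_left inner_scaleR_right power2_eq_square
            mult_zero_right add_0_left add_0_right mult.assoc)
    qed
    ultimately have "?c + 2 * t * (?w \<bullet> ?w) + t\<^sup>2 * (?w \<bullet> f ?w) \<le> ?c * (1 + t\<^sup>2 * (?w \<bullet> ?w))"
      by simp
    then have "t * (2 * (?w \<bullet> ?w)) \<le> t * (t * - (?w \<bullet> f ?w - ?c * (?w \<bullet> ?w)))"
      by (simp only: power2_eq_square) argo
    then have "2 * (?w \<bullet> ?w) \<le> t * - (?w \<bullet> f ?w - ?c * (?w \<bullet> ?w))"
      using t by (rule mult_left_le_imp_le)
    also have "\<dots> \<le> t * ?D" using t by (intro mult_left_mono) (linarith | simp)+
    also have "\<dots> = ?w \<bullet> ?w" unfolding t_def using D by simp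
    finally show False using ww by linarith
  qed
  then have fv: "f v = ?c *\<^sub>R v" by simp
  let ?S = "{x \<in> S. orthogonal v x}"
  have sub: "subspace ?S"
    using Suc.prems(1) by (auto simp: subspace_def orthogonal_clauses)
  have inv: "f ` ?S \<subseteq> ?S"
  proof
    fix y assume "y \<in> f ` ?S"
    then obtain x where x: "y = f x" "x \<in> S" "v \<bullet> x = 0" by (auto simp: orthogonal_def)
    have "v \<bullet> f x = f v \<bullet> x" using sym by simp
    also have "\<dots> = 0" using x by (subst fv) simp
    finally show "y \<in> ?S" using x Suc.prems(2) by (auto simp: orthogonal_def)
  qed
  have "dim ?S = d"
  proof -
    have "dim {y \<in> S. \<forall>x\<in>span {v}. orthogonal x y} + dim (span {v}) = dim S"
      using v Suc.prems(1) by (intro dim_subspace_orthogonal_to_vectors) (auto simp: span_minimal)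
    moreover have "{y \<in> S. \<forall>x\<in>span {v}. orthogonal x y} = ?S"
      by (auto simp: span_singleton orthogonal_clauses span_base dest: spec[of _ "1::real"])
    moreover have "dim (span {v}) = 1" using v by (auto simp: dim_span dim_singleton)
    ultimately show ?thesis using Suc.hyps(2) by simp
  qed
  then obtain B where B: "B \<subseteq> ?S" "pairwise orthogonal B"
      "\<forall>b\<in>B. norm b = 1 \<and> (\<exists>c. f b = c *\<^sub>R b)" "card B = d" "finite B"
    using Suc.hyps(1)[of ?S] sub inv by auto
  have "v \<notin> B" using B(1) v by (auto simp: orthogonal_def)
  then show ?case
    using B v fv Suc.hyps(2)
    by (intro exI[of _ "insert v B"]) (auto simp: pairwise_insert orthogonal_commute)
qed

lemma symmetric_diagonalization:
  fixes T :: "real ^ 'n ^ 'n"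
  assumes "T \<in> sym_mats"
  obtains Q l where "orthogonal_matrix Q" "T = conjm Q (diag l)"
proof -
  have T: "transpose T = T" using assms by (simp add: sym_mats_def)
  have "(T *v x) \<bullet> y = x \<bullet> (T *v y)" for x y :: "real ^ 'n"
    by (metis T dot_lmul_matrix vector_transpose_matrix)
  from symmetric_eigenbasis[OF matrix_vector_mul_linear this, of UNIV]
  obtain B where B: "pairwise orthogonal B" "\<forall>b\<in>B. norm b = 1 \<and> (\<exists>c. T *v b = c *\<^sub>R b)"
     "card B = CARD('n)" "finite B"
    by (auto simp: dim_UNIV)
  then obtain q where q: "bij_betw q (UNIV :: 'n set) B"
    using finite_same_card_bij[of "UNIV :: 'n set" B] by auto
  then have qB: "q i \<in> B" for i by (auto simp: bij_betw_def)
  have "\<exists>c. T *v q i = c *\<^sub>R q i" for i using B(2) qB by blast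
  then obtain l where l: "\<And>i. T *v q i = l i *\<^sub>R q i" by metis
  define Q :: "real ^ 'n ^ 'n" where "Q = (\<chi> i j. q j $ i)"
  have col: "column j Q = q j" for j by (simp add: Q_def column_def)
  have "inj q" using q by (simp add: bij_betw_def)
  then have orth: "orthogonal_matrix Q"
    unfolding orthogonal_matrix_orthonormal_columns col
  proof (intro conjI allI impI)
    fix i j :: 'n
    show "norm (q i) = 1" using B(2) qB by simp
    assume "i \<noteq> j"
    then have "q i \<noteq> q j" using \<open>inj q\<close> by (simp add: inj_eq)
    then show "orthogonal (q i) (q j)" by (rule pairwiseD[OF B(1) qB qB])
  qed
  have "T ** Q = Q ** diag (vec_lambda l)"
  proof -
    have "(T ** Q) $ i $ j = (T *v q j) $ i" for i j
      by (simp add: matrix_matrix_mult_def matrix_vector_mult_def Q_def)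
    moreover have "(Q ** diag (vec_lambda l)) $ i $ j = q j $ i * l j" for i j
      by (simp add: matrix_matrix_mult_def Q_def if_distrib[of "\<lambda>a. _ * a"] cong: if_cong)
    ultimately show ?thesis by (simp add: vec_eq_iff l)
  qed
  then have "T = conjm Q (diag (vec_lambda l))"
    using orthogonal_matrix_mult_cancel[OF orth]
    by (metis matrix_mul_assoc matrix_mul_rid)
  with orth show thesis by (rule that)
qed

subsection \<open>The gradient class\<close>

lemma transpose_plus: "transpose (A + B :: real ^ 'n ^ 'm) = transpose A + transpose B"
  by (simp add: vec_eq_iff transpose_def)

lemma conjm_plus: "conjm Q (A + B) = conjm Q A + conjm Q B"
proof -
  have "(A + B) ** C = A ** C + B ** C" for A B C :: "real ^ 'a ^ 'a"
    by (simp add: vec_eq_iff matrix_matrix_mult_def distrib_right sum.distrib)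
  then show ?thesis by (simp add: matrix_add_ldistrib)
qed

lemma conjm_scaleR: "conjm Q (t *\<^sub>R A) = t *\<^sub>R conjm Q A"
  by (simp add: matrix_scalar_ac scalar_matrix_assoc flip: scalar_mult_eq_scaleR)

lemma conjm_mat:
  assumes "orthogonal_matrix Q"
  shows "conjm Q (mat t) = (mat t :: real ^ 'n ^ 'n)"
proof -
  have t: "mat t = t *\<^sub>R (mat 1 :: real ^ 'n ^ 'n)" by (simp add: vec_eq_iff mat_def)
  have "conjm Q (mat 1) = mat 1" by (simp add: orthogonal_matrix_mult_cancel(2)[OF assms])
  then show ?thesis by (simp only: t conjm_scaleR)
qed

section \<open>Elementary symmetric functions of the eigenvalues as coefficients of a
  determinant\<close>

lemma det_conjm:
  assumes "orthogonal_matrix Q"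
  shows "det (conjm Q A) = det A"
proof -
  have "det (conjm Q A) = det A * det (Q ** transpose Q)"
    by (simp only: det_mul) simp
  then show ?thesis using orthogonal_matrix_mult_cancel(2)[OF assms] by simp
qed

lemma det_scaleR: "det (c *\<^sub>R A :: real ^ 'n ^ 'n) = c ^ CARD('n) * det A"
proof -
  have "c *\<^sub>R A = diag (\<chi> i. c) ** A"
    by (simp add: vec_eq_iff matrix_matrix_mult_def if_distrib[of "\<lambda>a. a * _"] cong: if_cong)
  then show ?thesis by (simp add: det_mul det_diag)
qed

text \<open>The Leibniz expansion of det (1 + t A), with t as the polynomial variable. Its
  coefficients are polynomials in the entries of A, so \<open>hess_F\<close> can be differentiated
  without differentiating eigenvalues.\<close>

definition rev_charpoly :: "real ^ 'n ^ 'n \<Rightarrow> real poly" where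
  "rev_charpoly A = (\<Sum>p | p permutes UNIV. smult (of_int (sign p))
     (\<Prod>i\<in>UNIV. [:if i = p i then 1 else 0, A $ i $ p i:]))"

lemma poly_rev_charpoly: "poly (rev_charpoly A) t = det (mat 1 + t *\<^sub>R A)"
  unfolding rev_charpoly_def det_def
  by (simp add: poly_sum poly_prod mat_def)

lemma rev_charpoly_eqI: "(\<And>t. det (mat 1 + t *\<^sub>R A) = poly p t) \<Longrightarrow> rev_charpoly A = p"
  by (rule poly_eq_poly_eq_iff[THEN iffD1]) (auto simp: poly_rev_charpoly)

lemma rev_charpoly_conjm:
  assumes "orthogonal_matrix Q"
  shows "rev_charpoly (conjm Q A) = rev_charpoly A"
proof (rule rev_charpoly_eqI)
  fix t
  have "mat 1 + t *\<^sub>R conjm Q A = conjm Q (mat 1 + t *\<^sub>R A)"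
    by (simp only: conjm_plus conjm_scaleR conjm_mat[OF assms])
  then show "det (mat 1 + t *\<^sub>R conjm Q A) = poly (rev_charpoly A) t"
    by (simp only: det_conjm[OF assms] poly_rev_charpoly)
qed

lemma rev_charpoly_diag: "rev_charpoly (diag l) = (\<Prod>i\<in>UNIV. [:1, l $ i:])"
proof (rule rev_charpoly_eqI)
  fix t
  have "mat 1 + t *\<^sub>R diag l = diag (\<chi> i. 1 + t * l $ i)"
    by (simp add: vec_eq_iff mat_def)
  then show "det (mat 1 + t *\<^sub>R diag l) = poly (\<Prod>i\<in>UNIV. [:1, l $ i:]) t"
    by (simp add: det_diag poly_prod)
qed

text \<open>The substitution of -1/t for t turns the characteristic polynomial into this one; only t
  = 0 has to be checked separately.\<close>

lemma rev_charpoly_eigval_vec: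
  assumes "is_eigval_vec A l"
  shows "rev_charpoly A = (\<Prod>i\<in>UNIV. [:1, l $ i:])"
proof (rule rev_charpoly_eqI)
  fix t
  show "det (mat 1 + t *\<^sub>R A) = poly (\<Prod>i\<in>UNIV. [:1, l $ i:]) t"
  proof (cases "t = 0")
    case False
    have "mat 1 + t *\<^sub>R A = (- t) *\<^sub>R (mat (- 1 / t) - A)"
      using False by (simp add: vec_eq_iff mat_def field_simps)
    then have "det (mat 1 + t *\<^sub>R A) = (- t) ^ CARD('a) * (\<Prod>i\<in>UNIV. - 1 / t - l $ i)"
      using assms by (simp only: det_scaleR is_eigval_vec_def)
    also have "\<dots> = (\<Prod>i\<in>UNIV. (- t) * (- 1 / t - l $ i))"
      by (simp only: prod.distrib prod_constant)
    also have "\<dots> = (\<Prod>i\<in>UNIV. 1 + t * l $ i)"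
      using False by (intro prod.cong refl) (simp add: field_simps)
    finally show ?thesis by (simp add: poly_prod)
  qed (simp add: poly_prod)
qed

lemma is_eigval_vec_conjm_diag:
  assumes "orthogonal_matrix Q"
  shows "is_eigval_vec (conjm Q (diag l)) l"
  unfolding is_eigval_vec_def
proof
  fix t
  have "mat t - conjm Q (diag l) = conjm Q (mat t) + (- 1) *\<^sub>R conjm Q (diag l)"
    by (simp add: conjm_mat[OF assms])
  also have "\<dots> = conjm Q (mat t + (- 1) *\<^sub>R diag l)" by (simp only: conjm_plus conjm_scaleR)
  also have "mat t + (- 1) *\<^sub>R diag l = diag (\<chi> i. t - l $ i)"
    by (simp add: vec_eq_iff mat_def)
  finally show "det (mat t - conjm Q (diag l)) = (\<Prod>i\<in>UNIV. t - l $ i)"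
    by (simp add: det_conjm[OF assms] det_diag)
qed

text \<open>Diagonalization provides one eigenvalue vector, which makes the choice in
  \<open>eigval_vec\<close> meaningful. Any choice leads to the same polynomial, so the order of the
  entries disappears.\<close>

lemma sigma_eigval_vec:
  assumes "A \<in> sym_mats"
  shows "sigma j (eigval_vec A) = coeff (rev_charpoly A) j"
proof -
  obtain Q l where "orthogonal_matrix Q" "A = conjm Q (diag l)"
    using symmetric_diagonalization[OF assms] .
  then have "is_eigval_vec A l" using is_eigval_vec_conjm_diag by blast
  then have "is_eigval_vec A (eigval_vec A)" unfolding eigval_vec_def by (rule someI)
  then show ?thesis
    by (simp add: rev_charpoly_eigval_vec sigma_eq_esym esym_def)
qed

lemma hess_F_eq: "A \<in> sym_mats \<Longrightarrow> hess_F k A = root k (coeff (rev_charpoly A) k)"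
  by (simp add: hess_F_def sigma_eigval_vec)

lemma conjm_sym: "A \<in> sym_mats \<Longrightarrow> conjm Q A \<in> sym_mats"
  by (simp add: sym_mats_def transpose_conjm)

lemma diag_sym: "diag l \<in> sym_mats"
  by (simp add: sym_mats_def)

lemma coeff_rev_charpoly_conjm_diag:
  assumes "orthogonal_matrix Q"
  shows "coeff (rev_charpoly (conjm Q (diag l))) j = esym (\<lambda>i. l $ i) UNIV j"
  by (simp add: rev_charpoly_conjm[OF assms] rev_charpoly_diag esym_def)

lemma Gamma_cone_conjm_diag:
  assumes "orthogonal_matrix Q"
  shows "eigval_vec (conjm Q (diag l)) \<in> Gamma_cone k \<longleftrightarrow> in_Gamma k (\<lambda>i. l $ i) UNIV"
  by (auto simp: Gamma_cone_def sigma_eigval_vec conjm_sym diag_sym in_Gamma_def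
      coeff_rev_charpoly_conjm_diag[OF assms] Suc_le_eq)

lemma coeff_rev_charpoly_differentiable:
  "(\<lambda>A. coeff (rev_charpoly A) k) differentiable (at A within X)"
proof -
  have "(\<lambda>A. coeff (\<Prod>i\<in>I. [:c i, A $ i $ p i:]) k) differentiable (at A within X)"
    if "finite I" for I :: "'a set" and c :: "'a \<Rightarrow> real" and p :: "'a \<Rightarrow> 'a" and k
    using that
  proof (induction I arbitrary: k rule: finite_induct)
    case (insert i I)
    have nth: "(\<lambda>A :: real ^ 'a ^ 'a. A $ i $ p i) differentiable (at A within X)"
      by (intro linear_imp_differentiable linearI) auto
    show ?case
    proof (cases k)
      case 0
      then show ?thesis using insert nth by simp
    next
      case (Suc m)
      then show ?thesis using insert nth by simp
    qed
  qed simp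
  then show ?thesis
    unfolding rev_charpoly_def coeff_sum coeff_smult
    by (intro differentiable_sum differentiable_mult differentiable_const) auto
qed

text \<open>The chain rule for sigma_k^(1/k): its partial derivatives in the eigenvalues, which turn
  out to be the eigenvalues of the gradient matrix.\<close>

definition F_grad_eigval :: "nat \<Rightarrow> real ^ 'n \<Rightarrow> real ^ 'n" where
  "F_grad_eigval k l = (\<chi> i. esym (\<lambda>i. l $ i) (UNIV - {i}) (k - 1) /
     (real k * root k (esym (\<lambda>i. l $ i) UNIV k) ^ (k - 1)))"

text \<open>The line through a symmetric matrix in a symmetric direction stays inside
  \<open>sym_mats\<close>, so the derivative within that set restricts to a two-sided derivative in
  t.\<close>

lemma hess_F_line_derivative:
  assumes "is_F_gradient k (conjm Q A) M" "A \<in> sym_mats" "H \<in> sym_mats"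
  shows "((\<lambda>t. hess_F k (conjm Q (A + t *\<^sub>R H))) has_real_derivative conjm (transpose Q) M \<bullet> H) (at 0)"
proof -
  let ?g = "\<lambda>t :: real. conjm Q (A + t *\<^sub>R H)"
  have g: "(?g has_derivative (\<lambda>t. t *\<^sub>R conjm Q H)) (at 0)"
    unfolding conjm_plus conjm_scaleR by (auto intro!: derivative_eq_intros)
  have "A + t *\<^sub>R H \<in> sym_mats" for t
    using assms(2,3) by (simp add: sym_mats_def transpose_plus transpose_scalar)
  then have "?g ` UNIV \<subseteq> sym_mats" by (intro image_subsetI conjm_sym)
  moreover have "(hess_F k has_derivative (\<lambda>H. M \<bullet> H)) (at (?g 0) within sym_mats)"
    using assms(1) by (simp add: is_F_gradient_def)
  ultimately have "(hess_F k has_derivative (\<lambda>H. M \<bullet> H)) (at (?g 0) within ?g ` UNIV)"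
    using has_derivative_subset by blast
  from has_derivative_in_compose[OF g this]
  have "((\<lambda>t. hess_F k (?g t)) has_derivative (\<lambda>t. t * (M \<bullet> conjm Q H))) (at 0)" by simp
  then show ?thesis by (simp add: has_field_derivative_def inner_conjm mult_commute_abs)
qed

text \<open>Off-diagonal entries vanish because the sign flip of one eigenvector fixes \<open>T\<close> and
  reverses the corresponding off-diagonal direction.\<close>

lemma F_gradient_diagonal:
  fixes Q M :: "real ^ 'n ^ 'n"
  assumes k: "1 \<le> k" and Q: "orthogonal_matrix Q" and l: "in_Gamma k (\<lambda>i. l $ i) UNIV"
    and M: "is_F_gradient k (conjm Q (diag l)) M"
  shows "M = conjm Q (diag (F_grad_eigval k l))"
proof -
  define N where "N = conjm (transpose Q) M"
  have symN: "N $ i $ j = N $ j $ i" for i j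
  proof -
    have "transpose N = N" using M
      by (simp only: N_def transpose_conjm is_F_gradient_def sym_mats_def mem_Collect_eq)
    then have "N $ i $ j = transpose N $ i $ j" by simp
    then show ?thesis by (simp add: transpose_def)
  qed
  have off: "N $ i $ j = 0" if "i \<noteq> j" for i j
  proof -
    define H :: "real ^ 'n ^ 'n" where
      "H = (\<chi> a b. if a = i \<and> b = j \<or> a = j \<and> b = i then 1 else 0)"
    have Hs: "H \<in> sym_mats"
      by (auto simp: sym_mats_def H_def transpose_def vec_eq_iff)
    define D :: "real ^ 'n ^ 'n" where "D = diag (\<chi> a. if a = i then - 1 else 1)"
    have D: "orthogonal_matrix D"
      by (auto simp: orthogonal_matrix D_def diag_mult_diag vec_eq_iff mat_def)
    have flip: "conjm D (diag l + t *\<^sub>R H) = diag l + (- t) *\<^sub>R H" for t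
      using that
      by (auto simp: D_def vec_eq_iff matrix_matrix_mult_def H_def if_distrib[of "\<lambda>a. a * _"]
          if_distrib[of "\<lambda>a. _ * a"] cong: if_cong)
    have sym: "diag l + t *\<^sub>R H \<in> sym_mats" for t
      using Hs by (auto simp: sym_mats_def transpose_plus transpose_scalar)
    let ?f = "\<lambda>t. hess_F k (conjm Q (diag l + t *\<^sub>R H))"
    have even: "?f (- t) = ?f t" for t
      using rev_charpoly_conjm[OF D, of "diag l + t *\<^sub>R H"]
      by (simp only: hess_F_eq conjm_sym sym rev_charpoly_conjm[OF Q] flip)
    have d: "(?f has_real_derivative N \<bullet> H) (at 0)"
      using M Hs unfolding N_def by (intro hess_F_line_derivative) (auto simp: diag_sym)
    have "((\<lambda>t. ?f (- t)) has_real_derivative - (N \<bullet> H)) (at 0)"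
      using DERIV_mirror[of ?f "N \<bullet> H" 0] d by simp
    then have "N \<bullet> H = - (N \<bullet> H)"
      unfolding even using d DERIV_unique by blast
    moreover have "N \<bullet> H = N $ i $ j + N $ j $ i"
    proof -
      have "N \<bullet> H = (\<Sum>a\<in>UNIV. \<Sum>b\<in>UNIV. N $ a $ b * H $ a $ b)"
        by (simp add: inner_vec_def)
      also have "\<dots> = (\<Sum>a\<in>UNIV. \<Sum>b\<in>UNIV. (if a = i \<and> b = j then N $ i $ j else 0) +
          (if a = j \<and> b = i then N $ j $ i else 0))"
        using that by (intro sum.cong refl) (auto simp: H_def)
      also have "\<dots> = N $ i $ j + N $ j $ i"
        by (simp add: sum.distrib if_distrib[of "\<lambda>a. sum a _"] sum.If_cases flip: if_if_eq_conj)
           (simp add: if_distrib sum.delta cong: if_cong)?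
      finally show ?thesis .
    qed
    ultimately show ?thesis using symN[of i j] by linarith
  qed
  have on: "N $ i $ i = F_grad_eigval k l $ i" for i
  proof -
    let ?a = "esym (\<lambda>i. l $ i) UNIV k" and ?b = "esym (\<lambda>i. l $ i) (UNIV - {i}) (k - 1)"
    have a: "0 < ?a" using l by (simp add: in_Gamma_def)
    \<comment> \<open>Moving along this diagonal direction changes only the i-th eigenvalue, and an
      elementary symmetric function is affine in each variable.\<close>
    have "hess_F k (conjm Q (diag l + t *\<^sub>R diag (axis i 1))) = root k (?a + t * ?b)" for t
    proof -
      let ?l = "l + t *\<^sub>R axis i 1"
      have "diag l + t *\<^sub>R diag (axis i 1) = diag ?l" by (simp add: vec_eq_iff)
      then have "hess_F k (conjm Q (diag l + t *\<^sub>R diag (axis i 1))) = root k (esym (\<lambda>j. ?l $ j) UNIV k)"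
        by (simp only: hess_F_eq conjm_sym diag_sym coeff_rev_charpoly_conjm_diag[OF Q])
      moreover have "esym (\<lambda>j. ?l $ j) (UNIV - {i}) m = esym (\<lambda>j. l $ j) (UNIV - {i}) m" for m
        unfolding esym_def by (intro arg_cong2[of _ _ _ _ coeff] prod.cong) (auto simp: axis_def)
      ultimately show ?thesis
        using k esym_remove[of UNIV i "\<lambda>j. ?l $ j" "k - 1"] esym_remove[of UNIV i "\<lambda>j. l $ j" "k - 1"]
        by (simp add: axis_def algebra_simps)
    qed
    moreover have "((\<lambda>t. root k (?a + t * ?b)) has_real_derivative
        inverse (real k * root k ?a ^ (k - 1)) * ?b) (at 0)"
      using k a by (auto intro!: derivative_eq_intros DERIV_real_root[THEN DERIV_chain2])
    moreover have "((\<lambda>t. hess_F k (conjm Q (diag l + t *\<^sub>R diag (axis i 1)))) has_real_derivative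
        N \<bullet> diag (axis i 1)) (at 0)"
      using M unfolding N_def by (intro hess_F_line_derivative diag_sym)
    ultimately have "N \<bullet> diag (axis i 1) = inverse (real k * root k ?a ^ (k - 1)) * ?b"
      using DERIV_unique by simp
    moreover have "N \<bullet> diag (axis i 1) = N $ i $ i"
      by (simp add: inner_vec_def axis_def if_distrib[of "\<lambda>a. _ * a"] cong: if_cong)
    ultimately show ?thesis by (simp add: F_grad_eigval_def field_simps)
  qed
  have "N = diag (F_grad_eigval k l)"
    using off on by (simp add: vec_eq_iff)
  then have "conjm Q (diag (F_grad_eigval k l)) = Q ** (transpose Q ** (M ** (Q ** transpose Q)))"
    unfolding N_def by (metis matrix_mul_assoc transpose_transpose)
  then show ?thesis by (simp add: orthogonal_matrix_mult_cancel[OF Q])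
qed

text \<open>Off \<open>sym_mats\<close> the vector chosen by \<open>eigval_vec\<close> may carry no
  information, so the coefficient formula is composed with the symmetrization \<open>P\<close> and
  differentiated on the whole space. As \<open>P\<close> is self-adjoint, the resulting gradient is
  symmetric.\<close>

lemma F_gradient_exists:
  fixes T :: "real ^ 'n ^ 'n"
  assumes k: "1 \<le> k" and T: "T \<in> sym_mats" and pos: "0 < coeff (rev_charpoly T) k"
  obtains M where "is_F_gradient k T M"
proof -
  define P :: "real ^ 'n ^ 'n \<Rightarrow> real ^ 'n ^ 'n" where "P A = (1 / 2) *\<^sub>R (A + transpose A)" for A
  have linP: "linear P"
    by (intro linearI) (auto simp: P_def transpose_plus transpose_scalar algebra_simps)
  have PT: "P A = A" if "A \<in> sym_mats" for A
    using that by (simp add: P_def sym_mats_def flip: scaleR_2)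
  have Psym: "P A \<in> sym_mats" for A
    by (simp add: P_def sym_mats_def transpose_plus transpose_scalar add.commute)
  have adj: "g \<bullet> P H = P g \<bullet> H" for g H
  proof -
    have "g \<bullet> transpose H = transpose g \<bullet> H"
      by (simp add: inner_vec_def transpose_def) (rule sum.swap)
    then show ?thesis by (simp add: P_def inner_add_left inner_add_right)
  qed
  obtain D where D: "((\<lambda>A. coeff (rev_charpoly A) k) has_derivative D) (at (P T))"
    using coeff_rev_charpoly_differentiable unfolding differentiable_def by blast
  have S: "((\<lambda>A. coeff (rev_charpoly (P A)) k) has_derivative (\<lambda>H. D (P H))) (at T)"
    by (rule has_derivative_compose[OF linear_imp_has_derivative[OF linP] D])
  define c where "c = inverse (real k * root k (coeff (rev_charpoly T) k) ^ (k - Suc 0))"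
  have r: "(root k has_derivative (*) c) (at (coeff (rev_charpoly (P T)) k))"
    using DERIV_real_root[of k "coeff (rev_charpoly T) k"] k pos PT[OF T]
    by (simp add: has_field_derivative_def c_def)
  have F: "((\<lambda>A. root k (coeff (rev_charpoly (P A)) k)) has_derivative (\<lambda>H. c * D (P H))) (at T)"
    by (rule has_derivative_compose[OF S r])
  have linD: "linear D" using D by (rule has_derivative_linear)
  define g where "g = (\<Sum>b\<in>Basis. D b *\<^sub>R b)"
  have g: "D H = g \<bullet> H" for H
  proof -
    have "D H = D (\<Sum>b\<in>Basis. (H \<bullet> b) *\<^sub>R b)" by (simp add: euclidean_representation)
    also have "\<dots> = (\<Sum>b\<in>Basis. (H \<bullet> b) * D b)"
      by (simp add: linear_sum[OF linD] linear_scale[OF linD])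
    finally show ?thesis by (simp add: g_def inner_sum_left inner_commute[of H] mult.commute)
  qed
  have "(\<lambda>H. c * D (P H)) = (\<lambda>H. (c *\<^sub>R P g) \<bullet> H)"
    by (simp add: g adj)
  then have "((\<lambda>A. root k (coeff (rev_charpoly (P A)) k)) has_derivative (\<lambda>H. (c *\<^sub>R P g) \<bullet> H)) (at T within sym_mats)"
    using F has_derivative_at_withinI by metis
  then have "(hess_F k has_derivative (\<lambda>H. (c *\<^sub>R P g) \<bullet> H)) (at T within sym_mats)"
    by (rule has_derivative_transform[rotated 2]) (auto simp: T PT hess_F_eq)
  moreover have "c *\<^sub>R P g \<in> sym_mats"
    using Psym[of g] by (simp add: sym_mats_def transpose_scalar)
  ultimately show thesis using that unfolding is_F_gradient_def by blast
qed

text \<open>Existence and uniqueness of the gradient give a description with the eigenframe and the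
  eigenvalue vector as independent parameters. That freedom allows a competitor to be built in the
  frame of a given matrix.\<close>

lemma Mclass_iff:
  fixes M :: "real ^ 'n ^ 'n"
  assumes k: "1 \<le> k"
  shows "M \<in> Mclass k \<longleftrightarrow> (\<exists>Q l. orthogonal_matrix Q \<and> in_Gamma k (\<lambda>i. l $ i) UNIV \<and>
    M = conjm Q (diag (F_grad_eigval k l)))"
proof
  assume "M \<in> Mclass k"
  then obtain T where T: "T \<in> sym_mats" "eigval_vec T \<in> Gamma_cone k" "is_F_gradient k T M"
    by (auto simp: Mclass_def)
  obtain Q l where Q: "orthogonal_matrix Q" "T = conjm Q (diag l)"
    using symmetric_diagonalization[OF T(1)] .
  with T have "in_Gamma k (\<lambda>i. l $ i) UNIV" by (simp add: Gamma_cone_conjm_diag)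
  with Q T F_gradient_diagonal[OF k] show "\<exists>Q l. orthogonal_matrix Q \<and> in_Gamma k (\<lambda>i. l $ i) UNIV \<and>
    M = conjm Q (diag (F_grad_eigval k l))" by blast
next
  assume "\<exists>Q l. orthogonal_matrix Q \<and> in_Gamma k (\<lambda>i. l $ i) UNIV \<and>
    M = conjm Q (diag (F_grad_eigval k l))"
  then obtain Q :: "real ^ 'n ^ 'n" and l where Q: "orthogonal_matrix Q" and l: "in_Gamma k (\<lambda>i. l $ i) UNIV"
    and M: "M = conjm Q (diag (F_grad_eigval k l))" by blast
  have sym: "conjm Q (diag l) \<in> sym_mats" by (simp add: conjm_sym diag_sym)
  have "0 < coeff (rev_charpoly (conjm Q (diag l))) k"
    using l by (simp add: coeff_rev_charpoly_conjm_diag[OF Q] in_Gamma_def)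
  then obtain M' where M': "is_F_gradient k (conjm Q (diag l)) M'"
    using F_gradient_exists[OF k sym] by blast
  then have "M' = M" using F_gradient_diagonal[OF k Q l] M by simp
  with M' sym l show "M \<in> Mclass k"
    unfolding Mclass_def using Gamma_cone_conjm_diag[OF Q] by blast
qed

subsection \<open>Eigenvalue inequalities in the gradient class\<close>

lemma F_grad_eigval_pos:
  assumes "1 \<le> k" "in_Gamma k (\<lambda>i. l $ i) UNIV"
  shows "0 < F_grad_eigval k l $ i"
proof -
  have "in_Gamma (k - 1) (\<lambda>i. l $ i) (UNIV - {i})"
    using assms by (intro in_Gamma_remove) auto
  then show ?thesis using assms by (simp add: F_grad_eigval_def in_Gamma_def)
qed

text \<open>The k-th power of the denominators is k^k sigma_k^(k-1), and its second factor is
  exactly the lower bound of \<open>prod_esym_remove_ge\<close>, so only k^(-k) survives.\<close>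

lemma prod_F_grad_eigval_ge:
  assumes "1 \<le> k" "in_Gamma k (\<lambda>i. l $ i) UNIV" "card J = k"
  shows "(1 / real k) ^ k \<le> (\<Prod>i\<in>J. F_grad_eigval k l $ i)"
proof -
  let ?s = "esym (\<lambda>i. l $ i) UNIV k" and ?e = "\<lambda>i. esym (\<lambda>i. l $ i) (UNIV - {i}) (k - 1)"
  have s: "0 < ?s" using assms by (simp add: in_Gamma_def)
  have "?s ^ (k - 1) \<le> (\<Prod>i\<in>J. ?e i)"
    using assms by (intro prod_esym_remove_ge) auto
  moreover have "(root k ?s ^ (k - 1)) ^ k = ?s ^ (k - 1)"
    using s assms by (metis power_mult mult.commute real_root_pow_pos2 less_imp_le zero_less_iff_neq_zero not_one_le_zero)
  moreover have "(\<Prod>i\<in>J. F_grad_eigval k l $ i) = (\<Prod>i\<in>J. ?e i) / (real k ^ k * (root k ?s ^ (k - 1)) ^ k)"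
    using assms by (simp add: F_grad_eigval_def prod_dividef power_mult_distrib)
  moreover have "(1 / real k) ^ k = ?s ^ (k - 1) / (real k ^ k * ?s ^ (k - 1))"
    using s by (simp add: power_one_over)
  moreover have "0 \<le> real k ^ k * ?s ^ (k - 1)" using s by simp
  ultimately show ?thesis by (simp only: divide_right_mono)
qed

text \<open>The set of eigenvalues is the finite range of the diagonal entries, so
  \<open>Min\<close> is a genuine minimum.\<close>

lemma lambda_min_conjm_diag_ge_iff:
  fixes Q :: "real ^ 'n ^ 'n"
  assumes Q: "orthogonal_matrix Q"
  shows "\<theta> \<le> lambda_min (conjm Q (diag m)) \<longleftrightarrow> (\<forall>i. \<theta> \<le> m $ i)"
proof -
  have "{c. \<exists>v. v \<noteq> 0 \<and> conjm Q (diag m) *v v = c *\<^sub>R v} = range (\<lambda>i. m $ i)" (is "?E = _")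
  proof (intro equalityI subsetI)
    fix c assume "c \<in> ?E"
    then obtain v where v: "v \<noteq> 0" "conjm Q (diag m) *v v = c *\<^sub>R v" by blast
    define w where "w = transpose Q *v v"
    have vw: "v = Q *v w" unfolding w_def by (simp only: orthogonal_matrix_mult_cancel[OF Q])
    have "m * w = transpose Q *v (Q *v (diag m *v (transpose Q *v v)))"
      by (simp only: orthogonal_matrix_mult_cancel[OF Q] w_def diag_vector)
    also have "\<dots> = transpose Q *v (c *\<^sub>R v)"
      unfolding v(2)[symmetric] by (simp only: matrix_vector_mul_assoc matrix_mul_assoc)
    also have "\<dots> = c *\<^sub>R w" unfolding w_def by (rule matrix_vector_mult_scaleR)
    finally have mw: "m $ i * w $ i = c * w $ i" for i
      by (metis vector_mult_component vector_scaleR_component real_scaleR_def)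
    have "w \<noteq> 0" using v(1) vw by auto
    then obtain i where "w $ i \<noteq> 0" by (auto simp: vec_eq_iff)
    with mw[of i] show "c \<in> range (\<lambda>i. m $ i)" by auto
  next
    fix c assume "c \<in> range (\<lambda>i. m $ i)"
    then obtain i where c: "c = m $ i" by blast
    let ?v = "Q *v axis i 1"
    have "transpose Q *v ?v = axis i 1" by (simp only: orthogonal_matrix_mult_cancel[OF Q])
    then have "?v \<noteq> 0" by (metis axis_eq_0_iff matrix_vector_mult_0_right zero_neq_one)
    moreover have "conjm Q (diag m) *v ?v = Q *v (diag m *v (transpose Q *v ?v))"
      by (simp only: matrix_vector_mul_assoc matrix_mul_assoc)
    moreover have "diag m *v axis i 1 = c *\<^sub>R axis i 1"
      by (simp add: diag_vector c vec_eq_iff axis_def)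
    ultimately show "c \<in> ?E"
      using matrix_vector_mult_scaleR[of Q c "axis i 1"]
      by (auto simp only: orthogonal_matrix_mult_cancel[OF Q])
  qed
  then show ?thesis by (simp add: lambda_min_def)
qed

text \<open>The exponents \<open>(k - 1)\<^sup>2 = k (k - 2) + 1\<close> differ by one, so with \<open>R = r ^ k\<close> the small
  eigenvalues of the gradient are at most \<open>2 ^ n / r\<close>.\<close>

lemma degenerate_F_grad_eigval:
  fixes \<epsilon> :: real
  assumes k: "2 \<le> k" "k \<le> CARD('n::finite)" and eps: "0 < \<epsilon>"
  shows "\<exists>A\<ge>1. \<forall>V :: 'n set. card V = CARD('n) - (k - 1) \<longrightarrow>
    (\<exists>l. in_Gamma k (\<lambda>i. l $ i) UNIV \<and> (\<forall>i. F_grad_eigval k l $ i \<le> A) \<and>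
      (\<forall>i. i \<notin> V \<longrightarrow> F_grad_eigval k l $ i \<le> \<epsilon>))"
proof -
  define r where "r = max 1 (2 ^ CARD('n) / \<epsilon>)"
  define R where "R = r ^ k"
  have r1: "1 \<le> r" by (simp add: r_def)
  have r2: "2 ^ CARD('n) / r \<le> \<epsilon>"
  proof -
    have "2 ^ CARD('n) / \<epsilon> \<le> r" by (simp add: r_def)
    then show ?thesis using eps r1 by (simp add: field_simps)
  qed
  have R1: "1 \<le> R" using r1 by (simp add: R_def one_le_power)
  show ?thesis
  \<comment> \<open>Here 2^n bounds the number of index sets and R^(k-1) the product over each of
    them, while the denominator of a gradient eigenvalue is at least 1. The bound is the same for
    all V.\<close>
  proof (intro exI[of _ "2 ^ CARD('n) * R ^ (k - 1)"] conjI allI impI)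
    have "1 * 1 \<le> 2 ^ CARD('n) * R ^ (k - 1)"
      using R1 by (intro mult_mono) (auto simp: one_le_power)
    then show "1 \<le> 2 ^ CARD('n) * R ^ (k - 1)" by simp
    fix V :: "'n set" assume V: "card V = CARD('n) - (k - 1)"
    have cV: "card (- V) = k - 1" using V k by (simp add: Compl_eq_Diff_UNIV card_Diff_subset)
    \<comment> \<open>Exactly k - 1 entries are large, so sigma_k is at least R^(k-1). Removing an
      index outside V leaves k - 2 large entries, so the numerator there is at most of order
      R^(k-2).\<close>
    define l :: "real ^ 'n" where "l = (\<chi> i. if i \<in> V then 1 else R)"
    let ?l = "\<lambda>i. l $ i"
    have lpos: "0 < ?l i" "1 \<le> ?l i" for i using R1 by (auto simp: l_def)
    have prodl: "(\<Prod>i\<in>K. ?l i) = R ^ card (K - V)" for K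
    proof -
      have "(\<Prod>i\<in>K. ?l i) = (\<Prod>i\<in>K. if i \<in> V then 1 else R)" by (simp add: l_def)
      also have "\<dots> = R ^ card (K - V)"
        by (simp add: prod.If_cases Diff_eq)
      finally show ?thesis .
    qed
    have esym_le: "esym ?l I j \<le> 2 ^ CARD('n) * R ^ d"
      if "\<And>K. K \<subseteq> I \<Longrightarrow> card K = j \<Longrightarrow> card (K - V) \<le> d" for I j d
    proof -
      have "esym ?l I j = (\<Sum>K | K \<subseteq> I \<and> card K = j. R ^ card (K - V))"
        by (simp add: esym_eq_sum prodl)
      also have "\<dots> \<le> (\<Sum>K | K \<subseteq> I \<and> card K = j. R ^ d)"
        using that R1 by (intro sum_mono power_increasing) auto
      also have "\<dots> = real (card {K. K \<subseteq> I \<and> card K = j}) * R ^ d" by simp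
      also have "\<dots> \<le> 2 ^ CARD('n) * R ^ d"
      proof (rule mult_right_mono)
        have "card {K. K \<subseteq> I \<and> card K = j} \<le> card (Pow (UNIV :: 'n set))"
          by (intro card_mono) auto
        then show "real (card {K. K \<subseteq> I \<and> card K = j}) \<le> 2 ^ CARD('n)"
          by (simp add: card_Pow del: Pow_UNIV)
      qed (use R1 in auto)
      finally show ?thesis .
    qed
    have ge: "R ^ card (K - V) \<le> esym ?l UNIV (card K)" for K
    proof -
      have "(\<Prod>i\<in>K. ?l i) \<le> (\<Sum>K' | K' \<subseteq> UNIV \<and> card K' = card K. \<Prod>i\<in>K'. ?l i)"
        using lpos by (intro member_le_sum prod_nonneg) (auto simp: less_imp_le)
      then show ?thesis by (simp add: esym_eq_sum prodl)
    qed
    have G: "in_Gamma k ?l UNIV"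
      unfolding in_Gamma_def
    proof (intro allI impI)
      fix j assume "j \<le> k"
      then obtain K :: "'n set" where "card K = j"
        using k by (metis le_trans obtain_subset_with_card_n)
      then show "0 < esym ?l UNIV j" using ge[of K] R1
        by (metis less_le_trans one_le_power zero_less_one)
    qed
    let ?s = "esym ?l UNIV k"
    obtain v where v: "v \<in> V" using V k by (cases "V = {}") auto
    have "insert v (- V) - V = - V" "card (insert v (- V)) = k" using v cV k by auto
    with ge[of "insert v (- V)"] have s: "R ^ (k - 1) \<le> ?s" using cV by simp
    have "root k (R ^ (k - 1)) = r ^ (k - 1)"
      unfolding R_def using r1 k
      by (intro real_root_pos_unique) (auto simp: mult.commute simp flip: power_mult)
    with s have root: "r ^ (k - 1) \<le> root k ?s"
      using k by (metis real_root_le_iff le_zero_eq not_gr_zero not_numeral_le_zero)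
    have d: "r ^ ((k - 1) * (k - 1)) \<le> real k * root k ?s ^ (k - 1)"
    proof -
      have "1 * (r ^ (k - 1)) ^ (k - 1) \<le> real k * root k ?s ^ (k - 1)"
        using root r1 k by (intro mult_mono power_mono) auto
      then show ?thesis by (simp add: power_mult)
    qed
    have f: "F_grad_eigval k l $ i \<le> (2 ^ CARD('n) * R ^ d) / r ^ ((k - 1) * (k - 1))"
      if "esym ?l (UNIV - {i}) (k - 1) \<le> 2 ^ CARD('n) * R ^ d" for i d
      unfolding F_grad_eigval_def using that d r1 R1 by (auto intro!: frac_le)
    have "F_grad_eigval k l $ i \<le> 2 ^ CARD('n) * R ^ (k - 1)" for i
    proof -
      have "card (K - V) \<le> k - 1" if "card K = k - 1" for K :: "'n set"
        using that by (metis Diff_subset card_mono finite)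
      then have "F_grad_eigval k l $ i \<le> (2 ^ CARD('n) * R ^ (k - 1)) / r ^ ((k - 1) * (k - 1))"
        by (intro f esym_le) auto
      also have "\<dots> \<le> (2 ^ CARD('n) * R ^ (k - 1)) / 1"
        using r1 R1 by (intro divide_left_mono) (auto simp: one_le_power)
      finally show ?thesis by simp
    qed
    moreover have "F_grad_eigval k l $ i \<le> \<epsilon>" if i: "i \<notin> V" for i
    proof -
      have "card (K - V) \<le> k - 2" if "K \<subseteq> UNIV - {i}" for K
      proof -
        have "card (K - V) \<le> card (- V - {i})" using that by (intro card_mono) auto
        then show ?thesis using i cV by simp
      qed
      then have "F_grad_eigval k l $ i \<le> (2 ^ CARD('n) * R ^ (k - 2)) / r ^ ((k - 1) * (k - 1))"
        by (intro f esym_le) auto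
      also have "\<dots> = 2 ^ CARD('n) / r"
      proof -
        obtain m where "k = m + 2" using k by (metis add.commute le_Suc_ex)
        then have "r ^ ((k - 1) * (k - 1)) = R ^ (k - 2) * r"
          by (simp add: R_def algebra_simps flip: power_mult power_Suc power_add)
        then show ?thesis using R1 by simp
      qed
      finally show ?thesis using r2 by simp
    qed
    ultimately show "\<exists>l. in_Gamma k (\<lambda>i. l $ i) UNIV \<and>
        (\<forall>i. F_grad_eigval k l $ i \<le> 2 ^ CARD('n) * R ^ (k - 1)) \<and>
        (\<forall>i. i \<notin> V \<longrightarrow> F_grad_eigval k l $ i \<le> \<epsilon>)"
      using G by blast
  qed
qed

text \<open>Any \<open>k\<close> eigenvalues have product at least \<open>k ^ (- k)\<close>, so one tiny eigenvalue leaves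
  room for at most \<open>k - 1\<close> eigenvalues below \<open>4 A\<close>.\<close>

lemma Mclass_comparison:
  fixes \<epsilon> :: real
  assumes k: "2 \<le> k" "k \<le> CARD('n::finite)" and eps: "0 < \<epsilon>"
  shows "\<exists>\<theta>>0. \<forall>M \<in> Mclass k. lambda_min M < \<theta> \<longrightarrow>
    (\<exists>(Q :: real ^ 'n ^ 'n) m m' V. orthogonal_matrix Q \<and> M = conjm Q (diag m) \<and> (\<forall>i. 0 < m $ i) \<and>
      conjm Q (diag m') \<in> Mclass k \<and> \<theta> \<le> lambda_min (conjm Q (diag m')) \<and> (\<forall>i. 0 < m' $ i) \<and>
      (\<forall>i\<in>V. 4 * m' $ i \<le> m $ i) \<and> (\<forall>i. i \<notin> V \<longrightarrow> m' $ i \<le> \<epsilon>))"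
proof -
  have k1: "1 \<le> k" using k by simp
  obtain A where A1: "1 \<le> A" and A: "\<And>V :: 'n set. card V = CARD('n) - (k - 1) \<Longrightarrow>
    \<exists>l. in_Gamma k (\<lambda>i. l $ i) UNIV \<and> (\<forall>i. F_grad_eigval k l $ i \<le> A) \<and>
      (\<forall>i. i \<notin> V \<longrightarrow> F_grad_eigval k l $ i \<le> \<epsilon>)"
    using degenerate_F_grad_eigval[OF k eps] by blast
  \<comment> \<open>If one eigenvalue is below \<theta> and k - 1 others are below 4 A, their
    product is below k^(-k). Read in the other direction, the same constant keeps the eigenvalues of
    the competitor, all at most A, above \<theta>.\<close>
  define \<theta> where "\<theta> = (1 / real k) ^ k / (4 * A) ^ (k - 1)"
  have \<theta>: "0 < \<theta>" using A1 k by (simp add: \<theta>_def)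
  have prod_le: "(1 / real k) ^ k \<le> f i * c ^ (k - 1)"
    if "i \<in> J" "card J = k" "(1 / real k) ^ k \<le> (\<Prod>i\<in>J. f i)" "\<And>j. j \<in> J \<Longrightarrow> f j \<le> c" "\<And>j. 0 < f j"
    for f :: "'n \<Rightarrow> real" and i c J
  proof -
    have "(\<Prod>j\<in>J. f j) = f i * (\<Prod>j\<in>J - {i}. f j)"
      using that by (intro prod.remove) auto
    also have "\<dots> \<le> f i * (\<Prod>j\<in>J - {i}. c)"
      using that by (intro mult_left_mono prod_mono) (auto simp: less_imp_le)
    finally show ?thesis using that by simp
  qed
  show ?thesis
  proof (intro exI[of _ \<theta>] conjI ballI impI \<theta>)
    fix M :: "real ^ 'n ^ 'n" assume M: "M \<in> Mclass k" "lambda_min M < \<theta>"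
    obtain Q l where Q: "orthogonal_matrix Q" and l: "in_Gamma k (\<lambda>i. l $ i) UNIV"
      and Ml: "M = conjm Q (diag (F_grad_eigval k l))"
      using M(1) Mclass_iff[OF k1] by blast
    let ?m = "F_grad_eigval k l"
    have mpos: "0 < ?m $ i" for i using F_grad_eigval_pos[OF k1 l] .
    obtain i0 where i0: "?m $ i0 < \<theta>"
      using M(2) lambda_min_conjm_diag_ge_iff[OF Q, of \<theta> ?m] unfolding Ml by (auto simp: not_le)
    have "(1 / real k) ^ k \<le> 1" using k by (intro power_le_one) auto
    moreover have "1 \<le> (4 * A) ^ (k - 1)" by (rule one_le_power) (use A1 in linarith)
    ultimately have "\<theta> \<le> 1" unfolding \<theta>_def by (simp add: divide_le_eq)
    define W where "W = {i. ?m $ i < 4 * A}"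
    have i0W: "i0 \<in> W" using i0 \<open>\<theta> \<le> 1\<close> A1 by (simp add: W_def)
    have "card W < k"
    proof (rule ccontr)
      assume "\<not> card W < k"
      then have "k - 1 \<le> card (W - {i0})" using i0W by simp
      then obtain J' where J': "J' \<subseteq> W - {i0}" "card J' = k - 1"
        by (metis obtain_subset_with_card_n)
      let ?J = "insert i0 J'"
      have cJ: "card ?J = k" using J' k by (subst card_insert_disjoint) auto
      have "(1 / real k) ^ k \<le> ?m $ i0 * (4 * A) ^ (k - 1)"
        using J' i0W cJ mpos prod_F_grad_eigval_ge[OF k1 l cJ]
        by (intro prod_le[of _ ?J]) (auto simp: W_def less_imp_le)
      also have "\<dots> < \<theta> * (4 * A) ^ (k - 1)"
        using i0 A1 by (intro mult_strict_right_mono) auto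
      also have "\<dots> = (1 / real k) ^ k" using A1 by (simp add: \<theta>_def)
      finally show False by simp
    qed
    then have "CARD('n) - (k - 1) \<le> card (- W)" by (simp add: Compl_eq_Diff_UNIV card_Diff_subset)
    \<comment> \<open>V is cut down to the exact size for which \<open>A\<close> was chosen. On V
      the given eigenvalues are at least 4 A, hence at least four times those of the
      competitor.\<close>
    then obtain V where V: "V \<subseteq> - W" "card V = CARD('n) - (k - 1)"
      by (metis obtain_subset_with_card_n)
    obtain l' where l': "in_Gamma k (\<lambda>i. l' $ i) UNIV" "\<And>i. F_grad_eigval k l' $ i \<le> A"
      "\<And>i. i \<notin> V \<Longrightarrow> F_grad_eigval k l' $ i \<le> \<epsilon>"
      using A[OF V(2)] by blast
    let ?m' = "F_grad_eigval k l'"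
    have m'pos: "0 < ?m' $ i" for i using F_grad_eigval_pos[OF k1 l'(1)] .
    have "\<theta> \<le> ?m' $ i" for i
    proof -
      have "k - 1 \<le> card (UNIV - {i})" using k by simp
      then obtain J' where J': "J' \<subseteq> UNIV - {i}" "card J' = k - 1"
        by (metis obtain_subset_with_card_n)
      let ?J = "insert i J'"
      have cJ: "card ?J = k" using J' k by (subst card_insert_disjoint) auto
      have "?m' $ j \<le> 4 * A" for j using l'(2)[of j] A1 by linarith
      then have "(1 / real k) ^ k \<le> ?m' $ i * (4 * A) ^ (k - 1)"
        using cJ m'pos prod_F_grad_eigval_ge[OF k1 l'(1) cJ]
        by (intro prod_le[of _ ?J]) auto
      then show ?thesis unfolding \<theta>_def using A1 by (subst pos_divide_le_eq) auto
    qed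
    moreover have "4 * ?m' $ i \<le> ?m $ i" if "i \<in> V" for i
      using l'(2)[of i] that V(1) by (auto simp: W_def not_less)
    moreover have "conjm Q (diag ?m') \<in> Mclass k"
      using Mclass_iff[OF k1] Q l'(1) by blast
    ultimately show "\<exists>Q m m' V. orthogonal_matrix Q \<and> M = conjm Q (diag m) \<and> (\<forall>i. 0 < m $ i) \<and>
      conjm Q (diag m') \<in> Mclass k \<and> \<theta> \<le> lambda_min (conjm Q (diag m')) \<and> (\<forall>i. 0 < m' $ i) \<and>
      (\<forall>i\<in>V. 4 * m' $ i \<le> m $ i) \<and> (\<forall>i. i \<notin> V \<longrightarrow> m' $ i \<le> \<epsilon>)"
      using Q Ml mpos m'pos l'(3) lambda_min_conjm_diag_ge_iff[OF Q]
      by (intro exI[of _ Q] exI[of _ ?m] exI[of _ ?m'] exI[of _ V]) auto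
  qed
qed

subsection \<open>Orthogonal invariance of Lebesgue measure and change of variables\<close>

lemma nn_integral_lborel_shift:
  fixes g :: "'a::euclidean_space \<Rightarrow> ennreal"
  assumes [measurable]: "g \<in> borel_measurable borel"
  shows "(\<integral>\<^sup>+x. g (c + x) \<partial>lborel) = (\<integral>\<^sup>+x. g x \<partial>lborel)"
proof -
  have "(\<integral>\<^sup>+x. g x \<partial>lborel) = (\<integral>\<^sup>+x. g x \<partial>distr lborel borel ((+) c))"
    by (simp add: lborel_distr_plus)
  also have "\<dots> = (\<integral>\<^sup>+x. g (c + x) \<partial>lborel)" by (subst nn_integral_distr) auto
  finally show ?thesis by simp
qed

text \<open>Uniqueness of Haar measure: test both measures against the unit ball \<open>B\<close>, which \<open>f\<close> preserves,
  and exchange the integrals of \<open>1\<^sub>A (f x) 1\<^sub>B (y - f x)\<close>.\<close>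

lemma lborel_distr_orthogonal:
  fixes f :: "'a::euclidean_space \<Rightarrow> 'a"
  assumes f: "orthogonal_transformation f"
  shows "distr lborel borel f = lborel"
proof (rule measure_eqI)
  have lin: "linear f" using f by (simp add: orthogonal_transformation_def)
  have [measurable]: "f \<in> borel_measurable borel"
    using lin by (intro borel_measurable_continuous_onI linear_continuous_on)
      (simp add: linear_conv_bounded_linear)
  obtain g where g: "\<And>y. f (g y) = y"
    using orthogonal_transformation_surj[OF f] by (metis surjD)
  fix A :: "'a set" assume "A \<in> sets (distr lborel borel f)"
  then have [measurable]: "A \<in> sets borel" by simp
  let ?B = "ball 0 1 :: 'a set"
  define p :: "'a \<Rightarrow> ennreal" where "p = indicator A"
  define b :: "'a \<Rightarrow> ennreal" where "b = indicator ?B"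
  have [measurable]: "p \<in> borel_measurable borel" "b \<in> borel_measurable borel"
    unfolding p_def b_def by (auto intro!: borel_measurable_indicator)
  have meas: "(\<lambda>(x, y). p (f x) * b (y - f x)) \<in> borel_measurable (lborel \<Otimes>\<^sub>M lborel)"
    "(\<lambda>(x, y). p (f x + y) * b (- f x)) \<in> borel_measurable (lborel \<Otimes>\<^sub>M lborel)"
    by measurable
  have "(\<integral>\<^sup>+x. p (f x) \<partial>lborel) * emeasure lborel ?B = (\<integral>\<^sup>+x. p (f x) * emeasure lborel ?B \<partial>lborel)"
    by (subst nn_integral_multc) measurable
  also have "\<dots> = (\<integral>\<^sup>+x. (\<integral>\<^sup>+y. p (f x) * b (y - f x) \<partial>lborel) \<partial>lborel)"
  proof (rule nn_integral_cong)
    fix x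
    have "emeasure lborel ?B = (\<integral>\<^sup>+y. b y \<partial>lborel)" by (simp add: b_def)
    also have "\<dots> = (\<integral>\<^sup>+y. b (- f x + y) \<partial>lborel)"
      by (rule nn_integral_lborel_shift[symmetric]) measurable
    finally show "p (f x) * emeasure lborel ?B = (\<integral>\<^sup>+y. p (f x) * b (y - f x) \<partial>lborel)"
      by (subst nn_integral_cmult) auto
  qed
  also have "\<dots> = (\<integral>\<^sup>+y. (\<integral>\<^sup>+x. p (f x) * b (y - f x) \<partial>lborel) \<partial>lborel)"
    using lborel_pair.Fubini'[OF meas(1)] by simp
  also have "\<dots> = (\<integral>\<^sup>+y. (\<integral>\<^sup>+x. p (f x + y) * b (- f x) \<partial>lborel) \<partial>lborel)"
  proof (rule nn_integral_cong)
    \<comment> \<open>For fixed y, translate x by the preimage \<open>g y\<close>. Since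
      \<open>f (g y + x) = y + f x\<close>, this moves y out of the factor \<open>b\<close> and into
      the factor \<open>p\<close>.\<close>
    fix y
    have "(\<integral>\<^sup>+x. p (f x) * b (y - f x) \<partial>lborel) =
        (\<integral>\<^sup>+x. p (f (g y + x)) * b (y - f (g y + x)) \<partial>lborel)"
      by (rule nn_integral_lborel_shift[symmetric]) measurable
    then show "(\<integral>\<^sup>+x. p (f x) * b (y - f x) \<partial>lborel) =
        (\<integral>\<^sup>+x. p (f x + y) * b (- f x) \<partial>lborel)"
      by (simp add: linear_add[OF lin] g add.commute)
  qed
  also have "\<dots> = (\<integral>\<^sup>+x. (\<integral>\<^sup>+y. p (f x + y) * b (- f x) \<partial>lborel) \<partial>lborel)"
    using lborel_pair.Fubini'[OF meas(2)] by simp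
  also have "\<dots> = (\<integral>\<^sup>+x. emeasure lborel A * b x \<partial>lborel)"
  proof (rule nn_integral_cong)
    fix x
    have "(\<integral>\<^sup>+y. p (f x + y) * b (- f x) \<partial>lborel) = (\<integral>\<^sup>+y. p (f x + y) \<partial>lborel) * b (- f x)"
      by (rule nn_integral_multc) measurable
    moreover have "(\<integral>\<^sup>+y. p (f x + y) \<partial>lborel) = (\<integral>\<^sup>+y. p y \<partial>lborel)"
      by (rule nn_integral_lborel_shift) measurable
    moreover have "b (- f x) = b x"
      using orthogonal_transformation_norm[OF f, of x] by (simp add: b_def indicator_def)
    moreover have "(\<integral>\<^sup>+y. p y \<partial>lborel) = emeasure lborel A" by (simp add: p_def)
    ultimately show "(\<integral>\<^sup>+y. p (f x + y) * b (- f x) \<partial>lborel) = emeasure lborel A * b x"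
      by (simp only:)
  qed
  also have "\<dots> = emeasure lborel A * emeasure lborel ?B"
  proof -
    have "emeasure lborel ?B = (\<integral>\<^sup>+x. b x \<partial>lborel)" by (simp add: b_def)
    then show ?thesis by (simp add: nn_integral_cmult)
  qed
  finally have eq: "(\<integral>\<^sup>+x. p (f x) \<partial>lborel) * emeasure lborel ?B = emeasure lborel A * emeasure lborel ?B" .
  \<comment> \<open>The volume of the ball may be cancelled in \<open>ennreal\<close> only because
    it is neither 0 nor infinite.\<close>
  have nz: "emeasure lborel ?B \<noteq> 0" "emeasure lborel ?B \<noteq> top"
  proof -
    have "emeasure lborel ?B = ennreal (unit_ball_vol (real DIM('a)))"
      using emeasure_ball[of 1 "0 :: 'a"] by simp
    moreover have "0 < unit_ball_vol (real DIM('a))" by simp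
    ultimately show "emeasure lborel ?B \<noteq> 0" "emeasure lborel ?B \<noteq> top"
      by (simp_all add: ennreal_eq_0_iff not_le)
  qed
  have "(\<integral>\<^sup>+x. p (f x) \<partial>lborel) = emeasure lborel A"
    using mult_divide_eq_ennreal[OF nz, of "\<integral>\<^sup>+x. p (f x) \<partial>lborel"]
      mult_divide_eq_ennreal[OF nz, of "emeasure lborel A"] unfolding eq by simp
  moreover have "emeasure (distr lborel borel f) A = (\<integral>\<^sup>+x. p (f x) \<partial>lborel)"
  proof -
    have "emeasure (distr lborel borel f) A = (\<integral>\<^sup>+y. p y \<partial>distr lborel borel f)" by (simp add: p_def)
    also have "\<dots> = (\<integral>\<^sup>+x. p (f x) \<partial>lborel)" by (subst nn_integral_distr) auto
    finally show ?thesis .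
  qed
  ultimately show "emeasure (distr lborel borel f) A = emeasure lborel A" by simp
qed simp

lemma measurable_matrix_vector_mult [measurable]: "(*v) (Q :: real ^ 'n ^ 'm) \<in> borel_measurable borel"
  by (intro borel_measurable_continuous_onI linear_continuous_on) (simp add: matrix_vector_mul_bounded_linear)

lemma measurable_vec_times [measurable]: "(*) (a :: real ^ 'n) \<in> borel_measurable borel"
proof -
  have "linear ((*) a)" by (intro linearI) (auto simp: vec_eq_iff algebra_simps)
  then show ?thesis
    by (intro borel_measurable_continuous_onI linear_continuous_on) (simp add: linear_conv_bounded_linear)
qed

lemma nn_integral_orthogonal:
  fixes Q :: "real ^ 'n ^ 'n"
  assumes Q: "orthogonal_matrix Q" and [measurable]: "h \<in> borel_measurable borel"
  shows "(\<integral>\<^sup>+z. h (Q *v z) \<partial>lborel) = (\<integral>\<^sup>+y. h y \<partial>lborel)"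
proof -
  have Q': "orthogonal_transformation ((*v) Q)"
    using Q by (simp add: orthogonal_transformation_matrix)
  have "(\<integral>\<^sup>+y. h y \<partial>lborel) = (\<integral>\<^sup>+y. h y \<partial>distr lborel borel ((*v) Q))"
    by (simp add: lborel_distr_orthogonal[OF Q'])
  also have "\<dots> = (\<integral>\<^sup>+z. h (Q *v z) \<partial>lborel)" by (subst nn_integral_distr) auto
  finally show ?thesis by simp
qed

lemma nn_integral_stretch:
  fixes a :: "real ^ 'n"
  assumes a: "\<And>i. 0 < a $ i" and [measurable]: "h \<in> borel_measurable borel"
  shows "(\<integral>\<^sup>+z. ennreal (\<Prod>i\<in>UNIV. a $ i) * h (a * z) \<partial>lborel) = (\<integral>\<^sup>+y. h y \<partial>lborel)"
proof -
  have T: "0 + (\<Sum>j\<in>Basis. (a \<bullet> j * (x \<bullet> j)) *\<^sub>R j) = a * x" for x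
  proof -
    have "(\<Sum>j\<in>Basis. (a \<bullet> j * (x \<bullet> j)) *\<^sub>R j) = (\<Sum>j\<in>Basis. ((a * x) \<bullet> j) *\<^sub>R j)"
      by (intro sum.cong refl) (auto simp: Basis_vec_def inner_axis)
    then show ?thesis by (simp add: euclidean_representation)
  qed
  have P: "(\<Prod>j\<in>Basis. \<bar>a \<bullet> j\<bar>) = (\<Prod>i\<in>UNIV. a $ i)"
  proof -
    have "(\<Prod>j\<in>Basis. \<bar>a \<bullet> j\<bar>) = (\<Prod>j\<in>(\<lambda>i. axis i (1::real)) ` UNIV. \<bar>a \<bullet> j\<bar>)"
      by (intro prod.cong) (auto simp: Basis_vec_def)
    also have "\<dots> = (\<Prod>i\<in>UNIV. \<bar>a \<bullet> axis i 1\<bar>)"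
      by (subst prod.reindex) (auto simp: inj_on_def axis_eq_axis)
    finally show ?thesis using a by (simp add: inner_axis abs_of_pos)
  qed
  have nz: "a \<bullet> j \<noteq> 0" if "j \<in> Basis" for j
  proof -
    obtain i where "j = axis i 1" using \<open>j \<in> Basis\<close> by (auto simp: Basis_vec_def)
    then show ?thesis using a[of i] by (simp add: inner_axis)
  qed
  have "lborel = density (distr lborel borel (\<lambda>x. 0 + (\<Sum>j\<in>Basis. (a \<bullet> j * (x \<bullet> j)) *\<^sub>R j)))
      (\<lambda>_. ennreal (\<Prod>j\<in>Basis. \<bar>a \<bullet> j\<bar>))"
    by (rule lborel_affine_euclidean[where t = 0]) (rule nz)
  then have "lborel = density (distr lborel borel ((*) a)) (\<lambda>_. ennreal (\<Prod>i\<in>UNIV. a $ i))"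
    unfolding T P .
  then have "(\<integral>\<^sup>+y. h y \<partial>lborel) =
      (\<integral>\<^sup>+y. h y \<partial>density (distr lborel borel ((*) a)) (\<lambda>_. ennreal (\<Prod>i\<in>UNIV. a $ i)))"
    by simp
  also have "\<dots> = (\<integral>\<^sup>+z. ennreal (\<Prod>i\<in>UNIV. a $ i) * h (a * z) \<partial>lborel)"
    by (simp add: nn_integral_density nn_integral_distr)
  finally show ?thesis by simp
qed

section \<open>Matrix square roots and the linear operators in an eigenframe\<close>

lemma conjm_diag_vector: "conjm Q (diag b) *v v = Q *v (b * (transpose Q *v v))"
  by (simp only: matrix_vector_mul_assoc[symmetric] diag_vector)

text \<open>Uniqueness: if q is an eigenvector of M with eigenvalue r^2 and r > 0, then S + r
  annihilates S q - r q. As S is positive semidefinite, S + r is injective, so S q = r q.\<close>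

lemma mat_sqrt_conjm_diag:
  fixes Q :: "real ^ 'n ^ 'n"
  assumes Q: "orthogonal_matrix Q" and m: "\<And>i. 0 < m $ i"
  shows "mat_sqrt (conjm Q (diag m)) = conjm Q (diag (\<chi> i. sqrt (m $ i)))"
  unfolding mat_sqrt_def
proof (rule the_equality, intro conjI allI)
  let ?a = "\<chi> i. sqrt (m $ i)" and ?S = "conjm Q (diag (\<chi> i. sqrt (m $ i)))"
  show "?S \<in> sym_mats" by (intro conjm_sym diag_sym)
  have aa: "?a * ?a = m" using m by (simp add: vec_eq_iff less_imp_le)
  show "?S ** ?S = conjm Q (diag m)" unfolding conjm_mult[OF Q] diag_mult_diag aa ..
  fix v :: "real ^ 'n"
  let ?w = "transpose Q *v v"
  have "v \<bullet> (?S *v v) = v \<bullet> (Q *v (?a * ?w))" by (simp only: conjm_diag_vector)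
  also have "\<dots> = ?w \<bullet> (?a * ?w)" by (metis dot_lmul_matrix transpose_matrix_vector)
  also have "\<dots> = (\<Sum>i\<in>UNIV. sqrt (m $ i) * (?w $ i)\<^sup>2)"
    unfolding inner_vec_def by (intro sum.cong refl) (simp add: power2_eq_square del: transpose_matrix_vector)
  also have "\<dots> \<ge> 0"
    using m by (intro sum_nonneg mult_nonneg_nonneg) (auto simp: less_imp_le)
  finally show "0 \<le> v \<bullet> (?S *v v)" .
next
  let ?S = "conjm Q (diag (\<chi> i. sqrt (m $ i)))"
  fix S assume S: "S \<in> sym_mats \<and> (\<forall>v. 0 \<le> v \<bullet> (S *v v)) \<and> S ** S = conjm Q (diag m)"
  have eig: "conjm Q (diag b) *v (Q *v axis i 1) = b $ i *\<^sub>R (Q *v axis i 1)" for b i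
  proof -
    have "b * axis i 1 = b $ i *\<^sub>R axis i 1" by (simp add: vec_eq_iff axis_def)
    then show ?thesis
      unfolding conjm_diag_vector
      by (simp only: orthogonal_matrix_mult_cancel[OF Q] matrix_vector_mult_scaleR)
  qed
  have "S *v (Q *v axis i 1) = ?S *v (Q *v axis i 1)" for i
  proof -
    define q where "q = Q *v axis i 1"
    define r where "r = sqrt (m $ i)"
    define w where "w = S *v q - r *\<^sub>R q"
    have r: "0 < r" "m $ i = r * r" using m[of i] by (auto simp: r_def)
    have "S *v (S *v q) = conjm Q (diag m) *v q"
      using S by (simp only: matrix_vector_mul_assoc)
    also have "\<dots> = (r * r) *\<^sub>R q" unfolding q_def eig r(2) ..
    finally have "S *v w = (- r) *\<^sub>R w"
      by (simp add: w_def matrix_vector_mult_diff_distrib matrix_vector_mult_scaleR scaleR_diff_right)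
    then have "0 \<le> w \<bullet> ((- r) *\<^sub>R w)"
      using S by metis
    then have "r * (w \<bullet> w) \<le> 0" by simp
    then have "w \<bullet> w \<le> 0" using r by (simp add: mult_le_0_iff)
    then have "w = 0" by (metis inner_gt_zero_iff not_less)
    then show ?thesis by (simp only: eig) (simp add: w_def q_def r_def)
  qed
  then have *: "(S ** Q) *v axis i 1 = (?S ** Q) *v axis i 1" for i
    by (simp only: matrix_vector_mul_assoc)
  have "S ** Q = ?S ** Q"
  proof -
    have "A $ j $ i = (A *v axis i 1) $ j" for A :: "real ^ 'n ^ 'n" and i j
      by (simp add: matrix_vector_mult_def axis_def if_distrib[of "\<lambda>a. _ * a"] cong: if_cong)
    then show ?thesis using * unfolding vec_eq_iff by metis
  qed
  then have "S ** (Q ** transpose Q) = ?S ** (Q ** transpose Q)"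
    by (simp only: matrix_mul_assoc)
  then show "S = ?S" by (simp only: orthogonal_matrix_mult_cancel[OF Q] matrix_mul_rid)
qed

lemma matrix_inv_unique:
  fixes A B :: "real ^ 'n ^ 'n"
  assumes "A ** B = mat 1" "B ** A = mat 1"
  shows "matrix_inv A = B"
proof -
  have "\<exists>B. A ** B = mat 1 \<and> B ** A = mat 1" using assms by blast
  then have inv: "A ** matrix_inv A = mat 1 \<and> matrix_inv A ** A = mat 1"
    unfolding matrix_inv_def by (rule someI_ex)
  have "matrix_inv A = matrix_inv A ** (A ** B)" by (simp only: assms matrix_mul_rid)
  also have "\<dots> = (matrix_inv A ** A) ** B" by (rule matrix_mul_assoc)
  also have "\<dots> = B" by (simp only: inv matrix_mul_lid)
  finally show ?thesis .
qed

text \<open>Twice the linear operator in the eigenframe, when \<open>a\<close> holds the square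
  roots of the eigenvalues and \<open>G\<close> is the rotated second difference. Zero entries of
  \<open>a\<close> are allowed, which the splitting by V uses.\<close>

definition kernel_integral :: "real \<Rightarrow> (real ^ 'n \<Rightarrow> real) \<Rightarrow> real ^ 'n \<Rightarrow> ennreal" where
  "kernel_integral s G a = (\<integral>\<^sup>+z. ennreal (G (a * z) / norm z powr (real CARD('n) + 2 * s)) \<partial>lborel)"

text \<open>For y = Q (a * z) the norm in the kernel becomes |Q z| = |z|, and the Jacobian cancels
  the determinant. Nonnegative second differences make the negative part vanish, so no difference of
  infinities arises.\<close>

lemma frac_lin_eq_kernel_integral:
  fixes Q :: "real ^ 'n ^ 'n"
  assumes Q: "orthogonal_matrix Q" and m: "\<And>i. 0 < m $ i"
    and [measurable]: "u \<in> borel_measurable borel"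
    and nonneg: "\<And>y. 0 \<le> second_diff u x y"
  shows "frac_lin s (conjm Q (diag m)) u x =
    ereal (1 / 2) * enn2ereal (kernel_integral s (\<lambda>z. second_diff u x (Q *v z)) (\<chi> i. sqrt (m $ i)))"
proof -
  let ?a = "\<chi> i. sqrt (m $ i)"
  let ?b = "\<chi> i. 1 / sqrt (m $ i)"
  let ?S = "conjm Q (diag ?b)"
  have "sqrt (m $ i) * (1 / sqrt (m $ i)) = 1" for i using m[of i] by simp
  then have ab: "?a * ?b = 1" "?b * ?a = 1" by (simp_all add: vec_eq_iff mult.commute)
  have a: "0 < ?a $ i" for i using m by simp
  have inv: "matrix_inv (mat_sqrt (conjm Q (diag m))) = ?S"
    unfolding mat_sqrt_conjm_diag[OF Q m]
    by (intro matrix_inv_unique) (simp_all only: conjm_mult[OF Q] diag_mult_diag ab diag_one conjm_mat[OF Q])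
  define P where "P = (\<Prod>i\<in>UNIV. ?a $ i)"
  have det: "det ?S = 1 / P"
    by (simp add: P_def det_conjm[OF Q] det_diag prod_dividef)
  have pa: "0 < P" unfolding P_def using a by (intro prod_pos) auto
  have norm: "norm (?S *v (Q *v (?a * z))) = norm z" for z
  proof -
    have "?S *v (Q *v (?a * z)) = Q *v ((?b * ?a) * z)"
      by (simp only: conjm_diag_vector orthogonal_matrix_mult_cancel[OF Q] mult.assoc)
    then have "?S *v (Q *v (?a * z)) = Q *v z" by (simp only: ab mult_1_left)
    then show ?thesis
      using Q by (simp add: orthogonal_transformation_matrix orthogonal_transformation_norm)
  qed
  define h where "h y = second_diff u x y / norm (?S *v y) powr (real CARD('n) + 2 * s) * det ?S" for y
  have h0: "0 \<le> h y" for y unfolding h_def det using nonneg[of y] pa by simp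
  have [measurable]: "(\<lambda>y. ennreal (h y)) \<in> borel_measurable borel"
    unfolding h_def second_diff_def by measurable
  have "(\<integral>\<^sup>+y. ennreal (h y) \<partial>lborel) = (\<integral>\<^sup>+y. ennreal (h (Q *v y)) \<partial>lborel)"
    by (rule nn_integral_orthogonal[OF Q, symmetric]) measurable
  also have "\<dots> = (\<integral>\<^sup>+z. ennreal P * ennreal (h (Q *v (?a * z))) \<partial>lborel)"
    unfolding P_def by (rule nn_integral_stretch[OF a, symmetric]) measurable
  also have "\<dots> = kernel_integral s (\<lambda>z. second_diff u x (Q *v z)) ?a"
    unfolding kernel_integral_def
  proof (intro nn_integral_cong)
    fix z
    have "ennreal P * ennreal (h (Q *v (?a * z))) =
      ennreal (P * h (Q *v (?a * z)))"
      using pa h0 by (intro ennreal_mult[symmetric]) (auto simp: less_imp_le)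
    also have "P * h (Q *v (?a * z)) =
       second_diff u x (Q *v (?a * z)) / norm z powr (real CARD('n) + 2 * s)"
      unfolding h_def norm det using pa by simp
    finally show "ennreal P * ennreal (h (Q *v (?a * z))) =
      ennreal (second_diff u x (Q *v (?a * z)) / norm z powr (real CARD('n) + 2 * s))" .
  qed
  finally have pos: "(\<integral>\<^sup>+y. ennreal (h y) \<partial>lborel) = kernel_integral s (\<lambda>z. second_diff u x (Q *v z)) ?a" .
  have "ennreal (- h y) = 0" for y using h0[of y] by (intro ennreal_neg) linarith
  then have neg: "(\<integral>\<^sup>+y. ennreal (- h y) \<partial>lborel) = 0" by (simp only: nn_integral_const mult_zero_left)
  show ?thesis
    unfolding frac_lin_def ext_integral_def inv h_def[symmetric] pos neg by (simp add: zero_ennreal.rep_eq)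
qed

subsection \<open>Integrals against the fractional kernel\<close>

text \<open>Each point of the support is charged to one ball on which f is controlled. Charging
  whole balls instead of shells costs only a constant and avoids polar coordinates.\<close>

lemma nn_integral_le_dyadic:
  fixes f :: "'a::euclidean_space \<Rightarrow> ennreal" and r c :: "nat \<Rightarrow> real"
  assumes cover: "\<And>z. f z \<noteq> 0 \<Longrightarrow> \<exists>j. norm z \<le> r j \<and> f z \<le> ennreal (c j)"
    and r: "\<And>j. 0 \<le> r j" and c: "\<And>j. 0 \<le> c j"
    and sums: "(\<lambda>j. c j * r j ^ DIM('a)) sums S"
  shows "(\<integral>\<^sup>+z. f z \<partial>lborel) \<le> ennreal (unit_ball_vol (real DIM('a)) * S)"
proof -
  let ?w = "unit_ball_vol (real DIM('a))"
  have "(\<integral>\<^sup>+z. f z \<partial>lborel) \<le> (\<integral>\<^sup>+z. (\<Sum>j. ennreal (c j) * indicator (cball 0 (r j)) (z :: 'a)) \<partial>lborel)"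
  proof (rule nn_integral_mono)
    fix z
    show "f z \<le> (\<Sum>j. ennreal (c j) * indicator (cball 0 (r j)) z)"
    proof (cases "f z = 0")
      case False
      with cover obtain j where j: "norm z \<le> r j" "f z \<le> ennreal (c j)" by blast
      then have "f z \<le> (\<Sum>i\<in>{j}. ennreal (c i) * indicator (cball 0 (r i)) z)" by simp
      also have "\<dots> \<le> (\<Sum>j. ennreal (c j) * indicator (cball 0 (r j)) z)"
        by (rule sum_le_suminf) auto
      finally show ?thesis .
    qed simp
  qed
  also have "\<dots> = (\<Sum>j. \<integral>\<^sup>+z. ennreal (c j) * indicator (cball 0 (r j)) (z :: 'a) \<partial>lborel)"
    by (rule nn_integral_suminf) (auto intro!: borel_measurable_times_ennreal borel_measurable_indicator)
  also have "\<dots> = (\<Sum>j. ennreal (?w * (c j * r j ^ DIM('a))))"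
  proof (rule suminf_cong)
    fix j
    have "(\<integral>\<^sup>+z. ennreal (c j) * indicator (cball 0 (r j)) (z :: 'a) \<partial>lborel) =
        ennreal (c j) * emeasure lborel (cball (0::'a) (r j))"
      by (rule nn_integral_cmult_indicator) simp
    also have "\<dots> = ennreal (c j) * ennreal (?w * r j ^ DIM('a))"
      using emeasure_cball[OF r[of j], of "0::'a"] by simp
    also have "\<dots> = ennreal (?w * (c j * r j ^ DIM('a)))"
      using r c by (simp add: ennreal_mult'[symmetric] mult_ac)
    finally show "(\<integral>\<^sup>+z. ennreal (c j) * indicator (cball 0 (r j)) (z :: 'a) \<partial>lborel) =
        ennreal (?w * (c j * r j ^ DIM('a)))" .
  qed
  also have "\<dots> = ennreal (?w * S)"
  proof -
    have s: "(\<lambda>j. ?w * (c j * r j ^ DIM('a))) sums (?w * S)" by (rule sums_mult[OF sums])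
    have "0 \<le> ?w * (c j * r j ^ DIM('a))" for j using r c by simp
    moreover from this have "0 \<le> ?w * S" by (rule sums_le[OF _ sums_zero s])
    ultimately have "(\<lambda>j. ennreal (?w * (c j * r j ^ DIM('a)))) sums ennreal (?w * S)"
      using s by (subst sums_ennreal)
    then show ?thesis by (rule sums_unique[symmetric])
  qed
  finally show ?thesis .
qed

text \<open>On [0, 1] the convex function 2^(-\<beta>) lies below its chord. Hence the geometric
  series is at most 2/\<beta>; with \<beta> = 2 - 2 s this is the blow-up rate that the factor 1 - s
  cancels as s tends to 1.\<close>

lemma half_powr_le:
  fixes \<beta> :: real
  assumes "0 \<le> \<beta>" "\<beta> \<le> 1"
  shows "(1 / 2) powr \<beta> \<le> 1 - \<beta> / 2"
proof -
  have "exp ((1 - \<beta>) *\<^sub>R 0 + \<beta> *\<^sub>R (- ln 2)) \<le> (1 - \<beta>) * exp 0 + \<beta> * exp (- ln 2 :: real)"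
    using assms by (intro convex_onD[OF exp_convex]) auto
  then show ?thesis by (simp add: powr_def ln_div exp_minus field_simps)
qed

text \<open>The factor 2^n comes from bounding the kernel on a ball by its size at half the radius,
  the remaining 2 from \<open>half_powr_le\<close>.\<close>

definition kernel_const :: "'a::euclidean_space itself \<Rightarrow> real" where
  "kernel_const _ = 2 ^ (DIM('a) + 1) * unit_ball_vol (real DIM('a))"

lemma kernel_const_pos: "0 < kernel_const TYPE('a::euclidean_space)"
  by (simp add: kernel_const_def)

lemma geometric_powr_bound:
  fixes \<beta> w P :: real
  assumes "0 < \<beta>" "\<beta> \<le> 1" "0 \<le> P"
  shows "(\<lambda>j. 2 ^ n * P * ((1 / 2) powr \<beta>) ^ j) sums (2 ^ n * P / (1 - (1 / 2) powr \<beta>))"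
    and "0 \<le> w \<Longrightarrow> w * (2 ^ n * P / (1 - (1 / 2) powr \<beta>)) \<le> 2 ^ (n + 1) * w * P / \<beta>"
proof -
  have q: "(1 / 2) powr \<beta> \<le> 1 - \<beta> / 2" using assms by (intro half_powr_le) auto
  then have "(1 / 2) powr \<beta> < 1" using assms by linarith
  then have "(\<lambda>j. ((1 / 2) powr \<beta>) ^ j) sums (1 / (1 - (1 / 2) powr \<beta>))"
    by (intro geometric_sums) simp
  from sums_mult[OF this, of "2 ^ n * P"]
  show "(\<lambda>j. 2 ^ n * P * ((1 / 2) powr \<beta>) ^ j) sums (2 ^ n * P / (1 - (1 / 2) powr \<beta>))" by simp
  assume "0 \<le> w"
  have "w * (2 ^ n * P / (1 - (1 / 2) powr \<beta>)) \<le> w * (2 ^ n * P / (\<beta> / 2))"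
    using q assms \<open>0 \<le> w\<close> by (intro mult_left_mono divide_left_mono) auto
  then show "w * (2 ^ n * P / (1 - (1 / 2) powr \<beta>)) \<le> 2 ^ (n + 1) * w * P / \<beta>"
    by (simp add: mult_ac)
qed

lemma nn_integral_norm_powr_inner:
  fixes \<beta> \<rho> :: real
  assumes \<beta>: "0 < \<beta>" "\<beta> \<le> 1" and \<rho>: "0 < \<rho>"
  shows "(\<integral>\<^sup>+z. ennreal (norm z powr (\<beta> - DIM('a))) * indicator (cball 0 \<rho>) (z :: 'a::euclidean_space) \<partial>lborel)
    \<le> ennreal (kernel_const TYPE('a) * \<rho> powr \<beta> / \<beta>)"
proof -
  let ?n = "DIM('a)"
  define r where "r j = \<rho> / 2 ^ j" for j :: nat
  define c where "c j = r j powr \<beta> / (r j / 2) ^ ?n" for j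
  have r: "0 < r j" for j using \<rho> by (simp add: r_def)
  have c: "0 \<le> c j" for j using r[of j] by (simp add: c_def)
  have "r j powr \<beta> = \<rho> powr \<beta> * ((1 / 2) powr \<beta>) ^ j" for j
  proof -
    have "r j powr \<beta> = (\<rho> * (1 / 2) ^ j) powr \<beta>" by (simp add: r_def power_one_over)
    also have "\<dots> = \<rho> powr \<beta> * ((1 / 2) ^ j) powr \<beta>" by (rule powr_mult)
    also have "((1 / 2 :: real) ^ j) powr \<beta> = ((1 / 2) powr \<beta>) ^ j"
      by (simp add: powr_realpow[symmetric] powr_powr mult.commute)
    finally show ?thesis .
  qed
  then have cr: "c j * r j ^ ?n = 2 ^ ?n * \<rho> powr \<beta> * ((1 / 2) powr \<beta>) ^ j" for j
    using r[of j] by (simp add: c_def power_divide field_simps)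
  have "(\<integral>\<^sup>+z. ennreal (norm z powr (\<beta> - ?n)) * indicator (cball 0 \<rho>) (z :: 'a) \<partial>lborel)
    \<le> ennreal (unit_ball_vol (real ?n) * (2 ^ ?n * \<rho> powr \<beta> / (1 - (1 / 2) powr \<beta>)))"
  proof (rule nn_integral_le_dyadic[where r = r and c = c])
    show "(\<lambda>j. c j * r j ^ ?n) sums (2 ^ ?n * \<rho> powr \<beta> / (1 - (1 / 2) powr \<beta>))"
      unfolding cr using \<beta> by (intro geometric_powr_bound) auto
    fix z :: 'a
    assume nz: "ennreal (norm z powr (\<beta> - ?n)) * indicator (cball 0 \<rho>) z \<noteq> 0"
    \<comment> \<open>At the origin \<open>powr\<close> has the value 0, so a nonzero integrand
      excludes z = 0.\<close>
    then have z: "z \<noteq> 0" "norm z \<le> \<rho>" by (auto simp: indicator_def split: if_splits)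
    obtain m where "(1 / 2) ^ m < norm z / \<rho>"
      using real_arch_pow_inv[of "norm z / \<rho>" "1 / 2"] z \<rho> by auto
    then have "r m < norm z" using \<rho> by (simp add: r_def field_simps power_one_over)
    moreover have "\<not> r 0 < norm z" using z by (simp add: r_def)
    ultimately obtain k where k: "\<not> r k < norm z" "r (Suc k) < norm z"
      using ex_least_nat_less[of "\<lambda>i. r i < norm z" m] by blast
    have k2: "r k / 2 \<le> norm z" using k(2) by (simp add: r_def)
    have "norm z powr (\<beta> - ?n) = norm z powr \<beta> / norm z ^ ?n"
      using z by (simp add: powr_diff powr_realpow)
    also have "\<dots> \<le> c k"
      unfolding c_def using k(1) k2 z \<beta> r[of k]
      by (intro frac_le powr_mono2 power_mono) auto
    finally show "\<exists>j. norm z \<le> r j \<and>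
        ennreal (norm z powr (\<beta> - ?n)) * indicator (cball 0 \<rho>) z \<le> ennreal (c j)"
      using k(1) z by (intro exI[of _ k]) (auto intro: ennreal_leI)
  qed (use r c in \<open>auto intro: less_imp_le\<close>)
  also have "\<dots> \<le> ennreal (kernel_const TYPE('a) * \<rho> powr \<beta> / \<beta>)"
    unfolding kernel_const_def using \<beta> by (intro ennreal_leI geometric_powr_bound(2)) auto
  finally show ?thesis .
qed

lemma nn_integral_norm_powr_outer:
  fixes \<beta> :: real
  assumes \<beta>: "0 < \<beta>" "\<beta> \<le> 1"
  shows "(\<integral>\<^sup>+z. ennreal (norm z powr (- \<beta> - DIM('a))) * indicator {z. 1 < norm z} (z :: 'a::euclidean_space) \<partial>lborel)
    \<le> ennreal (kernel_const TYPE('a) / \<beta>)"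
proof -
  let ?n = "DIM('a)"
  define c :: "nat \<Rightarrow> real" where "c j = (2 ^ j) powr (- \<beta>) / (2 ^ j) ^ ?n" for j
  have "(2 ^ j) powr (- \<beta>) = ((1 / 2) powr \<beta>) ^ j" for j
    by (simp add: powr_realpow[symmetric] powr_powr powr_divide powr_minus_divide power_one_over mult.commute)
  then have cr: "c j * (2 ^ Suc j) ^ ?n = 2 ^ ?n * 1 * ((1 / 2) powr \<beta>) ^ j" for j
    by (simp add: c_def power_mult_distrib)
  have "(\<integral>\<^sup>+z. ennreal (norm z powr (- \<beta> - ?n)) * indicator {z. 1 < norm z} (z :: 'a) \<partial>lborel)
    \<le> ennreal (unit_ball_vol (real ?n) * (2 ^ ?n * 1 / (1 - (1 / 2) powr \<beta>)))"
  proof (rule nn_integral_le_dyadic[where r = "\<lambda>j. 2 ^ Suc j" and c = c])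
    show "(\<lambda>j. c j * (2 ^ Suc j) ^ ?n) sums (2 ^ ?n * 1 / (1 - (1 / 2) powr \<beta>))"
      unfolding cr using \<beta> by (intro geometric_powr_bound) auto
    fix z :: 'a
    assume nz: "ennreal (norm z powr (- \<beta> - ?n)) * indicator {z. 1 < norm z} z \<noteq> 0"
    then have z: "1 < norm z" by (auto simp: indicator_def split: if_splits)
    obtain m where "norm z < 2 ^ m" using real_arch_pow[of 2 "norm z"] by auto
    moreover have "\<not> norm z < 2 ^ 0" using z by simp
    ultimately obtain k where k: "\<not> norm z < 2 ^ k" "norm z < 2 ^ Suc k"
      using ex_least_nat_less[of "\<lambda>i. norm z < 2 ^ i" m] by blast
    have "norm z powr (- \<beta> - ?n) = norm z powr (- \<beta>) / norm z ^ ?n"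
    proof -
      have "0 < norm z" using z by linarith
      then show ?thesis by (simp only: powr_diff powr_realpow)
    qed
    also have "\<dots> \<le> c k"
      unfolding c_def using k(1) z \<beta>
      by (intro frac_le powr_mono2' power_mono) auto
    finally show "\<exists>j. norm z \<le> 2 ^ Suc j \<and>
        ennreal (norm z powr (- \<beta> - ?n)) * indicator {z. 1 < norm z} z \<le> ennreal (c j)"
      using k(2) z by (intro exI[of _ k]) (auto intro: ennreal_leI)
  qed (auto simp: c_def)
  also have "\<dots> \<le> ennreal (kernel_const TYPE('a) / \<beta>)"
    unfolding kernel_const_def using \<beta> geometric_powr_bound(2)[of \<beta> 1 "unit_ball_vol (real ?n)" ?n]
    by (intro ennreal_leI) simp
  finally show ?thesis .
qed

text \<open>A vector shrunk in one coordinate is a convex combination of the vector and its mirror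
  image in that coordinate, and the kernel is invariant under the reflection.\<close>

lemma kernel_integral_shrink:
  fixes b :: "real ^ 'n"
  assumes conv: "convex_on UNIV G" and nonneg: "\<And>z. 0 \<le> G z" and [measurable]: "G \<in> borel_measurable borel"
    and c: "0 \<le> c" "c \<le> 1"
  shows "kernel_integral s G (\<chi> j. if j = i then c * b $ i else b $ j) \<le> kernel_integral s G b"
proof -
  let ?b = "\<chi> j. if j = i then c * b $ i else b $ j"
  define D :: "real ^ 'n ^ 'n" where "D = diag (\<chi> j. if j = i then - 1 else 1)"
  have D: "orthogonal_matrix D"
    by (auto simp: orthogonal_matrix D_def diag_mult_diag vec_eq_iff mat_def)
  have nD: "norm (D *v z) = norm z" for z
    using D by (simp add: orthogonal_transformation_matrix orthogonal_transformation_norm)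
  define h where "h z = ennreal (G (b * z) / norm z powr (real CARD('n) + 2 * s))" for z
  have [measurable]: "h \<in> borel_measurable borel" unfolding h_def by measurable
  have "G (?b * z) \<le> (1 + c) / 2 * G (b * z) + (1 - c) / 2 * G (b * (D *v z))" for z
  proof -
    have "?b * z = ((1 + c) / 2) *\<^sub>R (b * z) + ((1 - c) / 2) *\<^sub>R (b * (D *v z))"
      by (auto simp: vec_eq_iff D_def diag_vector field_simps)
    then show ?thesis
      using convex_onD[OF conv, of "(1 - c) / 2" "b * z" "b * (D *v z)"] c by (simp add: field_simps)
  qed
  then have "G (?b * z) / norm z powr (real CARD('n) + 2 * s) \<le>
      (1 + c) / 2 * (G (b * z) / norm z powr (real CARD('n) + 2 * s)) +
      (1 - c) / 2 * (G (b * (D *v z)) / norm (D *v z) powr (real CARD('n) + 2 * s))" for z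
    unfolding nD times_divide_eq_right add_divide_distrib[symmetric] by (intro divide_right_mono) auto
  then have "ennreal (G (?b * z) / norm z powr (real CARD('n) + 2 * s)) \<le>
      ennreal ((1 + c) / 2) * h z + ennreal ((1 - c) / 2) * h (D *v z)" for z
    unfolding h_def using c nonneg
    by (subst (1 2) ennreal_mult[symmetric], simp_all add: ennreal_plus[symmetric] del: ennreal_plus)
  then have "kernel_integral s G ?b \<le>
      (\<integral>\<^sup>+z. ennreal ((1 + c) / 2) * h z + ennreal ((1 - c) / 2) * h (D *v z) \<partial>lborel)"
    unfolding kernel_integral_def by (intro nn_integral_mono)
  also have "\<dots> = ennreal ((1 + c) / 2) * (\<integral>\<^sup>+z. h z \<partial>lborel) + ennreal ((1 - c) / 2) * (\<integral>\<^sup>+z. h (D *v z) \<partial>lborel)"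
    by (simp add: nn_integral_add nn_integral_cmult)
  also have "(\<integral>\<^sup>+z. h (D *v z) \<partial>lborel) = (\<integral>\<^sup>+z. h z \<partial>lborel)"
    by (rule nn_integral_orthogonal[OF D]) measurable
  also have "ennreal ((1 + c) / 2) * (\<integral>\<^sup>+z. h z \<partial>lborel) + ennreal ((1 - c) / 2) * (\<integral>\<^sup>+z. h z \<partial>lborel) =
      ennreal ((1 + c) / 2 + (1 - c) / 2) * (\<integral>\<^sup>+z. h z \<partial>lborel)"
    using c by (simp add: distrib_right ennreal_plus)
  also have "(1 + c) / 2 + (1 - c) / 2 = 1" by (simp add: field_simps)
  finally show ?thesis by (simp add: h_def kernel_integral_def)
qed

lemma kernel_integral_mono:
  fixes a b :: "real ^ 'n"
  assumes conv: "convex_on UNIV G" and nonneg: "\<And>z. 0 \<le> G z" and meas: "G \<in> borel_measurable borel"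
    and ab: "\<And>i. 0 \<le> a $ i" "\<And>i. a $ i \<le> b $ i"
  shows "kernel_integral s G a \<le> kernel_integral s G b"
proof -
  have "kernel_integral s G (\<chi> i. if i \<in> S then a $ i else b $ i) \<le> kernel_integral s G b" if "finite S" for S
    using that
  proof (induction S rule: finite_induct)
    case (insert x S)
    let ?b = "\<chi> i. if i \<in> S then a $ i else b $ i"
    \<comment> \<open>If \<open>b $ x = 0\<close> then also \<open>a $ x = 0\<close>, and division
      by zero yields the admissible ratio 0.\<close>
    have c: "0 \<le> a $ x / b $ x" "a $ x / b $ x \<le> 1" "a $ x = a $ x / b $ x * b $ x"
      using ab[of x] by (auto simp: divide_le_eq)
    have eq: "(\<chi> i. if i \<in> insert x S then a $ i else b $ i) =
        (\<chi> j. if j = x then a $ x / b $ x * ?b $ x else ?b $ j)"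
      using insert.hyps c(3) by (auto simp: vec_eq_iff)
    have "kernel_integral s G (\<chi> i. if i \<in> insert x S then a $ i else b $ i) \<le> kernel_integral s G ?b"
      unfolding eq by (rule kernel_integral_shrink[OF conv nonneg meas c(1,2)])
    also note insert.IH
    finally show ?case .
  qed simp
  from this[of UNIV] show ?thesis by simp
qed

text \<open>The vector a is the midpoint of its doubled restrictions to V and to the complement. The
  doubling acts on square roots of eigenvalues, so it costs a factor 4 in the eigenvalues.\<close>

lemma kernel_integral_split:
  fixes a :: "real ^ 'n"
  assumes conv: "convex_on UNIV G" and nonneg: "\<And>z. 0 \<le> G z" and [measurable]: "G \<in> borel_measurable borel"
  shows "kernel_integral s G a \<le>
    ennreal (1 / 2) * kernel_integral s G (\<chi> i. if i \<in> V then 2 * a $ i else 0) +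
    ennreal (1 / 2) * kernel_integral s G (\<chi> i. if i \<in> V then 0 else 2 * a $ i)"
proof -
  let ?a = "\<chi> i. if i \<in> V then 2 * a $ i else 0" and ?b = "\<chi> i. if i \<in> V then 0 else 2 * a $ i"
  let ?k = "\<lambda>z :: real ^ 'n. norm z powr (real CARD('n) + 2 * s)"
  have "G (a * z) \<le> 1 / 2 * G (?a * z) + 1 / 2 * G (?b * z)" for z
  proof -
    have "a * z = (1 / 2) *\<^sub>R (?a * z) + (1 / 2) *\<^sub>R (?b * z)"
      by (auto simp: vec_eq_iff)
    then show ?thesis
      using convex_onD[OF conv, of "1 / 2" "?a * z" "?b * z"] by simp
  qed
  then have "G (a * z) / ?k z \<le> 1 / 2 * (G (?a * z) / ?k z) + 1 / 2 * (G (?b * z) / ?k z)" for z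
    unfolding times_divide_eq_right add_divide_distrib[symmetric] by (intro divide_right_mono) auto
  then have "ennreal (G (a * z) / ?k z) \<le>
      ennreal (1 / 2) * ennreal (G (?a * z) / ?k z) + ennreal (1 / 2) * ennreal (G (?b * z) / ?k z)" for z
    using nonneg
    by (subst (1 2) ennreal_mult[symmetric], simp_all add: ennreal_plus[symmetric] del: ennreal_plus)
  then have "kernel_integral s G a \<le>
      (\<integral>\<^sup>+z. ennreal (1 / 2) * ennreal (G (?a * z) / ?k z) + ennreal (1 / 2) * ennreal (G (?b * z) / ?k z) \<partial>lborel)"
    unfolding kernel_integral_def by (intro nn_integral_mono)
  also have "\<dots> = ennreal (1 / 2) * kernel_integral s G ?a + ennreal (1 / 2) * kernel_integral s G ?b"
    unfolding kernel_integral_def by (subst nn_integral_add) (auto simp: nn_integral_cmult)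
  finally show ?thesis .
qed

lemma norm_vec_times_le:
  fixes b z :: "real ^ 'n"
  assumes "\<And>i. \<bar>b $ i\<bar> \<le> \<rho>"
  shows "norm (b * z) \<le> \<rho> * norm z"
proof -
  have \<rho>: "0 \<le> \<rho>" using assms by (metis abs_ge_zero order_trans)
  have "norm (b * z) \<le> norm (\<rho> *\<^sub>R z)"
    using assms \<rho> by (intro norm_le_componentwise_cart) (auto simp: abs_mult intro: mult_right_mono)
  then show ?thesis using \<rho> by simp
qed

text \<open>The quadratic bound is integrated over the unit ball and the linear one outside it. The
  radial exponents 2 - 2 s and 2 s - 1 are both positive because 1/2 < s < 1.\<close>

lemma kernel_integral_bound:
  fixes b :: "real ^ 'n"
  assumes s: "1 / 2 < s" "s < 1" and S: "0 \<le> S" and T: "0 \<le> T" and \<rho>: "0 \<le> \<rho>"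
    and b: "\<And>i. \<bar>b $ i\<bar> \<le> \<rho>"
    and GS: "\<And>z. G z \<le> S * (norm z)\<^sup>2" and GT: "\<And>z. G z \<le> T * norm z"
  shows "kernel_integral s G b \<le>
    ennreal (kernel_const TYPE(real ^ 'n) * (S * \<rho>\<^sup>2 / (2 - 2 * s) + T * \<rho> / (2 * s - 1)))"
proof -
  let ?n = "real CARD('n)" and ?C = "kernel_const TYPE(real ^ 'n)"
  let ?k = "\<lambda>z :: real ^ 'n. norm z powr (?n + 2 * s)"
  define p :: "real ^ 'n \<Rightarrow> ennreal" where
    "p z = ennreal (norm z powr ((2 - 2 * s) - ?n)) * indicator (cball 0 1) z" for z
  define q :: "real ^ 'n \<Rightarrow> ennreal" where
    "q z = ennreal (norm z powr (- (2 * s - 1) - ?n)) * indicator {z. 1 < norm z} z" for z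
  have [measurable]: "p \<in> borel_measurable borel" "q \<in> borel_measurable borel"
    unfolding p_def q_def
    by (intro borel_measurable_times_ennreal borel_measurable_indicator; simp)+
  have le: "ennreal (G (b * z) / ?k z) \<le> ennreal (S * \<rho>\<^sup>2) * p z + ennreal (T * \<rho>) * q z" for z
  proof (cases "z = 0")
    case False
    have nb: "norm (b * z) \<le> \<rho> * norm z" using b by (rule norm_vec_times_le)
    show ?thesis
    proof (cases "norm z \<le> 1")
      case True
      have "G (b * z) \<le> S * (\<rho> * norm z)\<^sup>2"
        using GS[of "b * z"] nb S by (meson mult_left_mono norm_ge_zero order_trans power_mono)
      also have "\<dots> = S * \<rho>\<^sup>2 * norm z powr 2"
        using False by (simp add: power_mult_distrib powr_numeral)
      finally have "G (b * z) / ?k z \<le> S * \<rho>\<^sup>2 * norm z powr 2 / ?k z"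
        by (intro divide_right_mono) auto
      also have "\<dots> = S * \<rho>\<^sup>2 * norm z powr ((2 - 2 * s) - ?n)"
        by (simp only: times_divide_eq_right[symmetric] powr_diff[symmetric]) (simp add: algebra_simps)
      finally have "ennreal (G (b * z) / ?k z) \<le> ennreal (S * \<rho>\<^sup>2) * p z"
        using True S by (simp add: p_def ennreal_mult'[symmetric] ennreal_leI)
      then show ?thesis by (metis add_increasing2 zero_le)
    next
      case gt: False
      have "G (b * z) \<le> T * (\<rho> * norm z)"
        using GT[of "b * z"] nb T by (meson mult_left_mono order_trans)
      also have "\<dots> = T * \<rho> * norm z powr 1"
        using False by simp
      finally have "G (b * z) / ?k z \<le> T * \<rho> * norm z powr 1 / ?k z"
        by (intro divide_right_mono) auto
      also have "\<dots> = T * \<rho> * norm z powr (- (2 * s - 1) - ?n)"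
        by (simp only: times_divide_eq_right[symmetric] powr_diff[symmetric]) (simp add: algebra_simps)
      finally have "ennreal (G (b * z) / ?k z) \<le> ennreal (T * \<rho>) * q z"
        using gt T \<rho> by (simp add: q_def ennreal_mult'[symmetric] ennreal_leI)
      then show ?thesis by (metis add_increasing zero_le)
    qed
  qed simp
  have "kernel_integral s G b \<le> (\<integral>\<^sup>+z. ennreal (S * \<rho>\<^sup>2) * p z + ennreal (T * \<rho>) * q z \<partial>lborel)"
    unfolding kernel_integral_def using le by (intro nn_integral_mono)
  also have "\<dots> = ennreal (S * \<rho>\<^sup>2) * (\<integral>\<^sup>+z. p z \<partial>lborel) + ennreal (T * \<rho>) * (\<integral>\<^sup>+z. q z \<partial>lborel)"
    by (simp add: nn_integral_add nn_integral_cmult)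
  also have "\<dots> \<le> ennreal (S * \<rho>\<^sup>2) * ennreal (?C / (2 - 2 * s)) + ennreal (T * \<rho>) * ennreal (?C / (2 * s - 1))"
  proof (intro add_mono mult_left_mono)
    show "(\<integral>\<^sup>+z. p z \<partial>lborel) \<le> ennreal (?C / (2 - 2 * s))"
      using nn_integral_norm_powr_inner[of "2 - 2 * s" 1, where 'a = "real ^ 'n"] s by (simp add: p_def)
    show "(\<integral>\<^sup>+z. q z \<partial>lborel) \<le> ennreal (?C / (2 * s - 1))"
      using nn_integral_norm_powr_outer[of "2 * s - 1", where 'a = "real ^ 'n"] s by (simp add: q_def)
  qed auto
  also have "\<dots> = ennreal (S * \<rho>\<^sup>2 * (?C / (2 - 2 * s)) + T * \<rho> * (?C / (2 * s - 1)))"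
    using S T \<rho> s kernel_const_pos[where 'a = "real ^ 'n"]
    by (simp add: ennreal_mult[symmetric] ennreal_plus[symmetric] less_imp_le del: ennreal_plus)
  also have "S * \<rho>\<^sup>2 * (?C / (2 - 2 * s)) + T * \<rho> * (?C / (2 * s - 1)) =
     ?C * (S * \<rho>\<^sup>2 / (2 - 2 * s) + T * \<rho> / (2 * s - 1))"
    by (simp add: algebra_simps)
  finally show ?thesis .
qed

subsection \<open>The viscosity inequality and the comparison argument\<close>

lemma second_diff_nonneg:
  assumes "convex_on UNIV u"
  shows "0 \<le> second_diff u x y"
proof -
  have "x = (1 / 2) *\<^sub>R (x + y) + (1 / 2) *\<^sub>R (x - y)"
    by (simp add: scaleR_add_right scaleR_diff_right flip: scaleR_add_left)
  then show ?thesis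
    using convex_onD[OF assms, of "1 / 2" "x + y" "x - y"] by (simp add: second_diff_def)
qed

lemma second_diff_convex:
  fixes Q :: "real ^ 'n ^ 'n"
  assumes "convex_on UNIV u"
  shows "convex_on UNIV (\<lambda>z. second_diff u x (Q *v z))"
proof (rule convex_onI)
  fix t :: real and a b :: "real ^ 'n"
  assume t: "0 < t" "t < 1"
  have "u (x + Q *v ((1 - t) *\<^sub>R a + t *\<^sub>R b)) \<le> (1 - t) * u (x + Q *v a) + t * u (x + Q *v b)"
    "u (x - Q *v ((1 - t) *\<^sub>R a + t *\<^sub>R b)) \<le> (1 - t) * u (x - Q *v a) + t * u (x - Q *v b)"
    using convex_onD[OF assms, of t "x + Q *v a" "x + Q *v b"]
      convex_onD[OF assms, of t "x - Q *v a" "x - Q *v b"] t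
    by (simp_all add: matrix_vector_right_distrib matrix_vector_mult_scaleR algebra_simps)
  then show "second_diff u x (Q *v ((1 - t) *\<^sub>R a + t *\<^sub>R b))
      \<le> (1 - t) * second_diff u x (Q *v a) + t * second_diff u x (Q *v b)"
    unfolding second_diff_def by (simp add: algebra_simps)
qed simp

lemma second_diff_lipschitz:
  assumes "L-lipschitz_on UNIV u"
  shows "second_diff u x y \<le> 2 * L * norm y"
proof -
  have "dist (u (x + y)) (u x) \<le> L * norm y" "dist (u (x - y)) (u x) \<le> L * norm y"
    using lipschitz_onD[OF assms, of "x + y" x] lipschitz_onD[OF assms, of "x - y" x]
    by (simp_all add: dist_norm)
  then show ?thesis by (simp add: second_diff_def dist_real_def)
qed

text \<open>The point (x, u x) is separated from the strict epigraph. A vertical hyperplane is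
  impossible because u is finite everywhere: testing with x - c would force c = 0. Letting the
  height decrease to u y gives the subgradient inequality.\<close>

lemma convex_subgradient:
  fixes u :: "'a::euclidean_space \<Rightarrow> real"
  assumes u: "convex_on UNIV u"
  obtains p where "\<And>y. u x + p \<bullet> (y - x) \<le> u y"
proof -
  let ?S = "{z :: 'a \<times> real. u (fst z) < snd z}"
  have "convex ?S"
  proof (rule convexI)
    fix z w :: "'a \<times> real" and s t :: real
    assume zw: "z \<in> ?S" "w \<in> ?S" and st: "0 \<le> s" "0 \<le> t" "s + t = 1"
    have "u (s *\<^sub>R fst z + t *\<^sub>R fst w) \<le> s * u (fst z) + t * u (fst w)"
    proof -
      have s: "s = 1 - t" using st by simp
      have "u ((1 - t) *\<^sub>R fst z + t *\<^sub>R fst w) \<le> (1 - t) * u (fst z) + t * u (fst w)"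
        using st by (intro convex_onD[OF u]) auto
      then show ?thesis unfolding s .
    qed
    also have "\<dots> < s * snd z + t * snd w"
    proof (cases "s = 0")
      case False
      then have "s * u (fst z) < s * snd z" using zw st by simp
      moreover have "t * u (fst w) \<le> t * snd w" using zw st by (intro mult_left_mono) auto
      ultimately show ?thesis by linarith
    qed (use zw st in auto)
    finally show "s *\<^sub>R z + t *\<^sub>R w \<in> ?S" by simp
  qed
  moreover have "(x, u x + 1) \<in> ?S" by simp
  then have "?S \<noteq> {}" by blast
  moreover have "{(x, u x)} \<inter> ?S = {}" by auto
  ultimately obtain a b where a: "a \<noteq> 0" "a \<bullet> (x, u x) \<le> b" "\<forall>z\<in>?S. b \<le> a \<bullet> z"
    using separating_hyperplane_sets[of "{(x, u x)}" ?S] by auto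
  obtain c d where ad: "a = (c, d)" by (cases a)
  have ge: "c \<bullet> x + d * u x \<le> c \<bullet> y + d * t" if "u y < t" for y t
    using a(2) a(3)[rule_format, of "(y, t)"] that by (simp add: ad)
  have "0 \<le> d" using ge[of x "u x + 1"] by (simp add: algebra_simps)
  moreover have "d \<noteq> 0"
  proof
    assume "d = 0"
    then have "c \<bullet> x \<le> c \<bullet> (x - c)" using ge[of "x - c" "u (x - c) + 1"] by simp
    then have "c \<bullet> c \<le> 0" by (simp add: inner_diff_right)
    then have "c = 0" by (metis inner_gt_zero_iff not_less)
    then show False using a(1) ad \<open>d = 0\<close> by (simp add: zero_prod_def)
  qed
  ultimately have d: "0 < d" by simp
  have "u x + (- (1 / d) *\<^sub>R c) \<bullet> (y - x) \<le> u y" for y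
  proof -
    have "c \<bullet> x + d * u x \<le> c \<bullet> y + d * u y"
    proof (rule field_le_epsilon)
      fix e :: real assume "0 < e"
      moreover have "d * (u y + e / d) = d * u y + e" using d by (simp add: distrib_left)
      ultimately show "c \<bullet> x + d * u x \<le> c \<bullet> y + d * u y + e"
        using ge[of y "u y + e / d"] d by simp
    qed
    then show ?thesis using d by (simp add: inner_diff_right field_simps)
  qed
  then show thesis by (rule that)
qed

lemma C2_closure_quadratic:
  fixes p x :: "real ^ 'n"
  shows "C2_closure N (\<lambda>y. b + p \<bullet> (y - x) + c * (norm (y - x))\<^sup>2)"
  unfolding C2_closure_def
proof (intro exI conjI ballI)
  fix y :: "real ^ 'n"
  show "((\<lambda>y. b + p \<bullet> (y - x) + c * (norm (y - x))\<^sup>2) has_derivative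
      (\<lambda>h. (p + (2 * c) *\<^sub>R (y - x)) \<bullet> h)) (at y)"
    unfolding power2_norm_eq_inner
    by (auto intro!: derivative_eq_intros simp: inner_add_left inner_diff_left inner_diff_right
        inner_commute algebra_simps)
  have "mat (2 * c) *v h = (2 * c) *\<^sub>R h" for h :: "real ^ 'n"
    by (simp add: vec_eq_iff mat_def matrix_vector_mult_def if_distrib[of "\<lambda>a. a * _"] cong: if_cong)
  then show "((\<lambda>y. p + (2 * c) *\<^sub>R (y - x)) has_derivative (\<lambda>h. mat (2 * c) *v h)) (at y)"
    by (auto intro!: derivative_eq_intros)
qed (intro continuous_intros)+

lemma ennreal_le_of_ereal:
  assumes "ereal \<eta> \<le> ereal c * (ereal (1 / 2) * enn2ereal X)" "0 \<le> c"
  shows "ennreal \<eta> \<le> ennreal (c / 2) * X"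
proof (cases "0 \<le> \<eta>")
  case True
  have "enn2ereal (ennreal (c / 2) * X) = ereal c * (ereal (1 / 2) * enn2ereal X)"
    using assms(2) by (simp add: times_ennreal.rep_eq enn2ereal_ennreal flip: mult.assoc)
  with assms True show ?thesis
    by (simp add: less_eq_ennreal.rep_eq enn2ereal_ennreal)
qed (simp add: ennreal_neg)

text \<open>The test function is a paraboloid supported by a subgradient; as it is only used in a
  ball of radius \<open>r\<close>, its contribution to the integral vanishes as \<open>r\<close> tends to \<open>0\<close>.\<close>

lemma viscosity_ge_pointwise:
  fixes \<Omega> :: "(real ^ 'n) set" and Q :: "real ^ 'n ^ 'n"
  assumes \<Omega>: "open \<Omega>" "x \<in> \<Omega>" and conv: "convex_on UNIV u" and sc: "semi_concave SC u"
    and s: "1 / 2 < s" "s < 1"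
    and visc: "viscosity_ge (\<lambda>v x. ereal (1 - s) * frac_hess k s v x) \<Omega> u (\<lambda>x. \<eta>)"
    and Q: "orthogonal_matrix Q" and m: "\<And>i. 0 < m $ i" and M: "conjm Q (diag m) \<in> Mclass k"
  shows "ennreal \<eta> \<le> ennreal ((1 - s) / 2) *
    kernel_integral s (\<lambda>z. second_diff u x (Q *v z)) (\<chi> i. sqrt (m $ i))"
proof -
  define a where "a = (\<chi> i. sqrt (m $ i))"
  have a: "0 < a $ i" for i using m by (simp add: a_def)
  define J where "J = kernel_integral s (\<lambda>z. second_diff u x (Q *v z)) a"
  have SC: "0 \<le> SC" and cont: "continuous_on UNIV u"
    and scD: "\<And>y. second_diff u x y \<le> SC * (norm y)\<^sup>2"
    using sc by (auto simp: semi_concave_def)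
  have [measurable]: "u \<in> borel_measurable borel"
    using cont by (rule borel_measurable_continuous_onI)
  define A where "A = Max (range (\<lambda>i. a $ i))"
  define \<alpha> where "\<alpha> = Min (range (\<lambda>i. a $ i))"
  have aA: "a $ i \<le> A" and a\<alpha>: "\<alpha> \<le> a $ i" for i by (simp_all add: A_def \<alpha>_def)
  have \<alpha>: "0 < \<alpha>" using a by (simp add: \<alpha>_def)
  have A: "0 < A" using a aA by (meson less_le_trans)
  have nA: "norm (a * z) \<le> A * norm z" for z
    using a aA by (intro norm_vec_times_le) (auto simp: abs_of_pos)
  have n\<alpha>: "\<alpha> * norm z \<le> norm (a * z)" for z
  proof -
    have "norm (\<alpha> *\<^sub>R z) \<le> norm (a * z)"
      using a\<alpha> a \<alpha> by (intro norm_le_componentwise_cart) (auto simp: abs_mult abs_of_pos intro: mult_right_mono)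
    then show ?thesis using \<alpha> by simp
  qed
  have nQ: "norm (Q *v z) = norm z" for z
    using Q by (simp add: orthogonal_transformation_matrix orthogonal_transformation_norm)
  obtain p where p: "\<And>y. u x + p \<bullet> (y - x) \<le> u y" using convex_subgradient[OF conv, of x] by blast
  \<comment> \<open>The subgradient bounds u from below at the reflected point, so semi-concavity
    bounds it from above at y.\<close>
  have above: "u y \<le> u x + p \<bullet> (y - x) + SC * (norm (y - x))\<^sup>2" for y
  proof -
    have "second_diff u x (y - x) \<le> SC * (norm (y - x))\<^sup>2" by (rule scD)
    moreover have "u x + p \<bullet> (- (y - x)) \<le> u (x - (y - x))" using p[of "x - (y - x)"] by simp
    ultimately show ?thesis by (simp add: second_diff_def inner_diff_right)
  qed
  \<comment> \<open>Raising the coefficient from SC to SC + 1 makes the contact at x strict.\<close>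
  define \<psi> where "\<psi> y = u x + p \<bullet> (y - x) + (SC + 1) * (norm (y - x))\<^sup>2" for y
  obtain r0 where r0: "0 < r0" "ball x r0 \<subseteq> \<Omega>" using \<Omega> openE by blast
  define K where "K = 2 * (SC + 1)"
  have K: "0 < K" using SC by (simp add: K_def)
  define \<beta> where "\<beta> = 2 - 2 * s"
  have \<beta>: "0 < \<beta>" "\<beta> \<le> 1" using s by (auto simp: \<beta>_def)
  define B where "B = K * A\<^sup>2 * (kernel_const TYPE(real ^ 'n) / \<beta>)"
  have B: "0 < B" using K A \<beta> kernel_const_pos[where 'a = "real ^ 'n"] by (simp add: B_def)
  have est: "ennreal \<eta> \<le> ennreal ((1 - s) / 2) * (J + ennreal (B * (r / \<alpha>) powr \<beta>))"
    if r: "0 < r" "r \<le> r0" for r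
  proof -
    define v where "v y = (if y \<in> ball x r then \<psi> y else u y)" for y
    have "u y < \<psi> y" if "y \<noteq> x" for y
    proof -
      have "0 < (norm (y - x))\<^sup>2" using that by simp
      then show ?thesis using above[of y] unfolding \<psi>_def distrib_right by linarith
    qed
    moreover have "\<psi> x = u x" by (simp add: \<psi>_def)
    moreover have "C2_closure (ball x r) \<psi>" unfolding \<psi>_def by (rule C2_closure_quadratic)
    moreover have "ball x r \<subseteq> \<Omega>" using r r0(2) by (meson order_trans subset_ball)
    ultimately have "ereal \<eta> \<le> ereal (1 - s) * frac_hess k s (\<lambda>y. if y \<in> ball x r then \<psi> y else u y) x"
      using visc[unfolded viscosity_ge_def, rule_format, of x "ball x r" \<psi>] \<Omega>(2) r by simp
    then have "ereal \<eta> \<le> ereal (1 - s) * frac_hess k s v x" by (simp only: v_def[abs_def])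
    also have "\<dots> \<le> ereal (1 - s) * frac_lin s (conjm Q (diag m)) v x"
      unfolding frac_hess_def using M s by (intro ereal_mult_left_mono INF_lower) auto
    finally have le: "ereal \<eta> \<le> ereal (1 - s) * frac_lin s (conjm Q (diag m)) v x" .
    have mem: "x + y \<in> ball x r \<longleftrightarrow> norm y < r" "x - y \<in> ball x r \<longleftrightarrow> norm y < r" for y
      by (simp_all add: dist_norm)
    \<comment> \<open>The ball is symmetric about x, so x + y and x - y lie in it together and the
      linear part of \<psi> cancels.\<close>
    have sd: "second_diff v x y = (if norm y < r then K * (norm y)\<^sup>2 else second_diff u x y)" for y
    proof -
      have "v (x + y) = (if norm y < r then \<psi> (x + y) else u (x + y))"
        "v (x - y) = (if norm y < r then \<psi> (x - y) else u (x - y))"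
        by (simp_all only: v_def mem)
      moreover have "v x = u x" using r by (simp add: v_def \<psi>_def)
      ultimately show ?thesis
        by (simp add: second_diff_def) (simp add: \<psi>_def K_def algebra_simps)
    qed
    have [measurable]: "\<psi> \<in> borel_measurable borel"
      unfolding \<psi>_def by (intro borel_measurable_continuous_onI continuous_intros)
    have [measurable]: "v \<in> borel_measurable borel"
      unfolding v_def by (intro measurable_If_set) auto
    have sd0: "0 \<le> second_diff v x y" for y
      using sd[of y] second_diff_nonneg[OF conv] K by simp
    let ?Gv = "\<lambda>z. second_diff v x (Q *v z)" and ?Gu = "\<lambda>z. second_diff u x (Q *v z)"
    let ?n = "real CARD('n)"
    define q :: "real ^ 'n \<Rightarrow> ennreal" where
      "q z = ennreal (norm z powr (\<beta> - ?n)) * indicator (cball 0 (r / \<alpha>)) z" for z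
    have [measurable]: "q \<in> borel_measurable borel"
      unfolding q_def by (intro borel_measurable_times_ennreal borel_measurable_indicator; simp)
    define g :: "real ^ 'n \<Rightarrow> ennreal" where
      "g z = ennreal (?Gu (a * z) / norm z powr (?n + 2 * s))" for z
    have [measurable]: "g \<in> borel_measurable borel"
      unfolding g_def second_diff_def by measurable
    have "ennreal (?Gv (a * z) / norm z powr (?n + 2 * s)) \<le> g z + ennreal (K * A\<^sup>2) * q z" for z
    proof (cases "norm (a * z) < r")
      case False
      then have "ennreal (?Gv (a * z) / norm z powr (?n + 2 * s)) = g z"
        by (simp add: sd nQ g_def)
      then show ?thesis by simp
    next
      case True
      show ?thesis
      proof (cases "z = 0")
        case False
        have "\<alpha> * norm z \<le> r" using n\<alpha>[of z] True by linarith
        then have zr: "norm z \<le> r / \<alpha>" using \<alpha> by (simp add: field_simps)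
        have "?Gv (a * z) = K * (norm (a * z))\<^sup>2" using True by (simp add: sd nQ)
        also have "\<dots> \<le> K * (A * norm z)\<^sup>2"
          using nA K by (intro mult_left_mono power_mono) auto
        also have "\<dots> = K * A\<^sup>2 * norm z powr 2"
          using False by (simp add: power_mult_distrib powr_numeral)
        finally have "?Gv (a * z) / norm z powr (?n + 2 * s) \<le> K * A\<^sup>2 * norm z powr 2 / norm z powr (?n + 2 * s)"
          by (intro divide_right_mono) auto
        also have "\<dots> = K * A\<^sup>2 * norm z powr (\<beta> - ?n)"
          by (simp only: times_divide_eq_right[symmetric] powr_diff[symmetric]) (simp add: \<beta>_def algebra_simps)
        finally have "ennreal (?Gv (a * z) / norm z powr (?n + 2 * s)) \<le> ennreal (K * A\<^sup>2) * q z"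
          using zr K by (simp add: q_def ennreal_mult'[symmetric] ennreal_leI)
        then show ?thesis by (metis add_increasing zero_le)
      qed simp
    qed
    then have "kernel_integral s ?Gv a \<le> (\<integral>\<^sup>+z. g z + ennreal (K * A\<^sup>2) * q z \<partial>lborel)"
      unfolding kernel_integral_def by (intro nn_integral_mono)
    also have "\<dots> = J + ennreal (K * A\<^sup>2) * (\<integral>\<^sup>+z. q z \<partial>lborel)"
    proof -
      have "(\<integral>\<^sup>+z. g z \<partial>lborel) = J"
        unfolding g_def[abs_def] J_def kernel_integral_def ..
      then show ?thesis by (simp add: nn_integral_add nn_integral_cmult)
    qed
    also have "\<dots> \<le> J + ennreal (K * A\<^sup>2) * ennreal (kernel_const TYPE(real ^ 'n) * (r / \<alpha>) powr \<beta> / \<beta>)"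
      using nn_integral_norm_powr_inner[OF \<beta>, of "r / \<alpha>", where 'a = "real ^ 'n"] r \<alpha>
      by (intro add_left_mono mult_left_mono) (auto simp: q_def)
    also have "\<dots> = J + ennreal (B * (r / \<alpha>) powr \<beta>)"
      using K by (simp add: ennreal_mult'[symmetric] B_def mult_ac)
    finally have J: "kernel_integral s ?Gv a \<le> J + ennreal (B * (r / \<alpha>) powr \<beta>)" .
    have "ennreal \<eta> \<le> ennreal ((1 - s) / 2) * kernel_integral s ?Gv a"
      using le s unfolding frac_lin_eq_kernel_integral[OF Q m \<open>v \<in> borel_measurable borel\<close> sd0] a_def
      by (intro ennreal_le_of_ereal) auto
    also have "\<dots> \<le> ennreal ((1 - s) / 2) * (J + ennreal (B * (r / \<alpha>) powr \<beta>))"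
      by (rule mult_left_mono[OF J]) simp
    finally show ?thesis .
  qed
  have "ennreal \<eta> \<le> ennreal ((1 - s) / 2) * J"
  proof (cases J)
    case (real j)
    have "\<eta> \<le> (1 - s) / 2 * j"
    proof (rule field_le_epsilon)
      fix e :: real assume e: "0 < e"
      \<comment> \<open>Solves B (r/\<alpha>)^\<beta> = e for r, capped by \<open>r0\<close> so that
        the ball stays inside the open set.\<close>
      define r where "r = min r0 (\<alpha> * (e / B) powr (1 / \<beta>))"
      have r: "0 < r" "r \<le> r0" using r0 \<alpha> e B by (auto simp: r_def)
      have "r / \<alpha> \<le> (e / B) powr (1 / \<beta>)"
        using \<alpha> by (simp add: r_def pos_divide_le_eq mult.commute)
      then have "(r / \<alpha>) powr \<beta> \<le> ((e / B) powr (1 / \<beta>)) powr \<beta>"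
        using r \<alpha> \<beta> by (intro powr_mono2) auto
      also have "\<dots> = e / B" using \<beta> e B by (simp add: powr_powr)
      finally have eB: "B * (r / \<alpha>) powr \<beta> \<le> e" using B by (simp add: field_simps)
      have "ennreal \<eta> \<le> ennreal ((1 - s) / 2 * (j + B * (r / \<alpha>) powr \<beta>))"
        using est[OF r] real s B by (simp add: ennreal_mult'[symmetric] ennreal_plus[symmetric] del: ennreal_plus)
      then have "\<eta> \<le> (1 - s) / 2 * (j + B * (r / \<alpha>) powr \<beta>)"
        using s real B by (subst (asm) ennreal_le_iff) auto
      also have "\<dots> \<le> (1 - s) / 2 * j + 1 * e"
        using eB s B real unfolding distrib_left by (intro add_mono mult_mono) auto
      finally show "\<eta> \<le> (1 - s) / 2 * j + e" by simp
    qed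
    then show ?thesis using real s by (simp add: ennreal_mult'[symmetric] ennreal_leI)
  next
    case top
    then show ?thesis using s by (simp add: ennreal_mult_top)
  qed
  then show ?thesis by (simp add: J_def a_def)
qed

text \<open>The assumptions \<open>small\<close> and \<open>lower\<close> make the contribution of the directions outside \<open>V\<close> at most
  half of the left-hand side, so it can be absorbed.\<close>

lemma kernel_integral_le_of_lower_bound:
  fixes Q :: "real ^ 'n ^ 'n"
  assumes conv: "convex_on UNIV u" and lip: "L-lipschitz_on UNIV u" and sc: "semi_concave SC u"
    and s: "1 / 2 < s" "s < 1" and Q: "orthogonal_matrix Q"
    and m: "\<And>i. 0 < m $ i" and m': "\<And>i. 0 < m' $ i"
    and V: "\<And>i. i \<in> V \<Longrightarrow> 4 * m' $ i \<le> m $ i" and \<rho>: "0 \<le> \<rho>" "\<And>i. i \<notin> V \<Longrightarrow> m' $ i \<le> (\<rho> / 2)\<^sup>2"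
    and small: "(1 - s) * (kernel_const TYPE(real ^ 'n) * (SC * \<rho>\<^sup>2 / (2 - 2 * s) + 2 * L * \<rho> / (2 * s - 1))) \<le> 2 * \<eta>"
    and lower: "ennreal \<eta> \<le> ennreal ((1 - s) / 2) *
      kernel_integral s (\<lambda>z. second_diff u x (Q *v z)) (\<chi> i. sqrt (m' $ i))"
  shows "kernel_integral s (\<lambda>z. second_diff u x (Q *v z)) (\<chi> i. sqrt (m' $ i)) \<le>
    kernel_integral s (\<lambda>z. second_diff u x (Q *v z)) (\<chi> i. sqrt (m $ i))"
proof -
  let ?G = "\<lambda>z. second_diff u x (Q *v z)"
  define C where "C = kernel_const TYPE(real ^ 'n)"
  have C: "0 < C" by (simp add: C_def kernel_const_pos)
  have SC: "0 \<le> SC" and cont: "continuous_on UNIV u"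
    and scD: "\<And>y. second_diff u x y \<le> SC * (norm y)\<^sup>2"
    using sc by (auto simp: semi_concave_def)
  have L: "0 \<le> L" using lip by (rule lipschitz_on_nonneg)
  have [measurable]: "u \<in> borel_measurable borel"
    using cont by (rule borel_measurable_continuous_onI)
  have Gm: "?G \<in> borel_measurable borel" unfolding second_diff_def by measurable
  have Gc: "convex_on UNIV ?G" by (rule second_diff_convex[OF conv])
  have G0: "0 \<le> ?G z" for z by (rule second_diff_nonneg[OF conv])
  have nQ: "norm (Q *v z) = norm z" for z
    using Q by (simp add: orthogonal_transformation_matrix orthogonal_transformation_norm)
  have GS: "?G z \<le> SC * (norm z)\<^sup>2" for z using scD[of "Q *v z"] by (simp add: nQ)
  have GL: "?G z \<le> 2 * L * norm z" for z
    using second_diff_lipschitz[OF lip, of x "Q *v z"] by (simp add: nQ)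
  let ?a = "\<chi> i. sqrt (m' $ i)"
  let ?b = "\<chi> i. if i \<in> V then 2 * ?a $ i else 0" and ?c = "\<chi> i. if i \<in> V then 0 else 2 * ?a $ i"
  note bound = kernel_integral_bound[OF s SC _ _ _ GS GL, folded C_def]
  \<comment> \<open>Finiteness is what permits subtracting half of this integral from both sides at
    the end.\<close>
  have "kernel_integral s ?G ?a \<noteq> top"
  proof -
    have "\<bar>?a $ i\<bar> \<le> (\<Sum>i\<in>UNIV. \<bar>?a $ i\<bar>)" for i by (rule member_le_sum) auto
    from bound[OF _ _ this] L show ?thesis by (auto simp: top_unique sum_nonneg)
  qed
  then obtain j where j: "kernel_integral s ?G ?a = ennreal j" "0 \<le> j" by (cases "kernel_integral s ?G ?a") auto
  have "kernel_integral s ?G ?b \<le> kernel_integral s ?G (\<chi> i. sqrt (m $ i))"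
  proof (rule kernel_integral_mono[OF Gc G0 Gm])
    fix i
    show "0 \<le> ?b $ i" using m'[of i] by simp
    show "?b $ i \<le> (\<chi> i. sqrt (m $ i)) $ i"
    proof (cases "i \<in> V")
      case True
      have "sqrt (4 * m' $ i) \<le> sqrt (m $ i)" using V[OF True] by simp
      then show ?thesis using True by (simp add: real_sqrt_mult)
    qed (use m[of i] in simp)
  qed
  moreover have "kernel_integral s ?G ?c \<le> ennreal j"
  proof -
    have "\<bar>?c $ i\<bar> \<le> \<rho>" for i
    proof (cases "i \<in> V")
      case False
      then have "sqrt (m' $ i) \<le> \<rho> / 2"
        using \<rho> by (intro real_le_lsqrt) auto
      then show ?thesis using False m'[of i] by simp
    qed (use \<rho> in simp)
    then have "kernel_integral s ?G ?c \<le> ennreal (C * (SC * \<rho>\<^sup>2 / (2 - 2 * s) + 2 * L * \<rho> / (2 * s - 1)))"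
      using bound[of \<rho> ?c] L \<rho> by simp
    also have "\<dots> \<le> ennreal j"
    proof (rule ennreal_leI)
      have "\<eta> \<le> (1 - s) / 2 * j"
        using lower s j by (simp add: ennreal_mult'[symmetric])
      then have "(1 - s) * (C * (SC * \<rho>\<^sup>2 / (2 - 2 * s) + 2 * L * \<rho> / (2 * s - 1))) \<le> (1 - s) * j"
        using small unfolding C_def by linarith
      then show "C * (SC * \<rho>\<^sup>2 / (2 - 2 * s) + 2 * L * \<rho> / (2 * s - 1)) \<le> j"
        using s by (simp add: mult_le_cancel_left_pos)
    qed
    finally show ?thesis .
  qed
  moreover have "ennreal j \<le> ennreal (1 / 2) * kernel_integral s ?G ?b + ennreal (1 / 2) * kernel_integral s ?G ?c"
    using kernel_integral_split[OF Gc G0 Gm, of s ?a V] j by simp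
  ultimately have le: "ennreal j \<le> ennreal (1 / 2) * kernel_integral s ?G (\<chi> i. sqrt (m $ i)) + ennreal (1 / 2) * ennreal j"
    by (meson add_mono mult_left_mono order_trans zero_le)
  show ?thesis
  proof (cases "kernel_integral s ?G (\<chi> i. sqrt (m $ i))")
    case (real i)
    have "ennreal (1 / 2 * i + 1 / 2 * j) = ennreal (1 / 2 * i) + ennreal (1 / 2 * j)"
      using real j by (intro ennreal_plus) auto
    also have "\<dots> = ennreal (1 / 2) * ennreal i + ennreal (1 / 2) * ennreal j"
      using real j by (intro arg_cong2[of _ _ _ _ "(+)"] ennreal_mult) auto
    finally have "ennreal j \<le> ennreal (1 / 2 * i + 1 / 2 * j)"
      using le real by (simp only:)
    then have "j \<le> i" using real j by (subst (asm) ennreal_le_iff) auto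
    then show ?thesis using real j by (simp add: ennreal_leI)
  qed simp
qed

text \<open>Here \<theta> is chosen before s, and serves all s in [\<sigma>, 1); this gives
  stability as s tends to 1. The bound \<sigma> > 1/2 keeps the tail constant 1/(2 s - 1) under
  control.\<close>

lemma frac_hess_eq_theta:
  fixes k :: nat and \<eta> L SC \<sigma> :: real
  assumes k: "2 \<le> k" "k \<le> CARD('n::finite)" and \<eta>: "0 < \<eta>" and \<sigma>: "1 / 2 < \<sigma>"
  shows "\<exists>\<theta>>0. \<forall>s (\<Omega> :: (real ^ 'n) set) u.
    \<sigma> \<le> s \<and> s < 1 \<and> open \<Omega> \<and> convex_on UNIV u \<and> L-lipschitz_on UNIV u \<and> semi_concave SC u \<and>
    viscosity_ge (\<lambda>v x. ereal (1 - s) * frac_hess k s v x) \<Omega> u (\<lambda>x. \<eta>) \<longrightarrow>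
    (\<forall>x\<in>\<Omega>. frac_hess k s u x = frac_hess_theta k s \<theta> u x)"
proof (cases "0 \<le> L \<and> 0 \<le> SC")
  \<comment> \<open>No function satisfies the hypotheses with a negative constant, so any positive
    \<theta> will do.\<close>
  case False
  have "\<not> (L-lipschitz_on UNIV u \<and> semi_concave SC u)" for u :: "real ^ 'n \<Rightarrow> real"
    using False lipschitz_on_nonneg[of L UNIV u] by (auto simp: semi_concave_def)
  then show ?thesis by (intro exI[of _ 1]) auto
next
  case True
  then have L: "0 \<le> L" and SC: "0 \<le> SC" by auto
  define C where "C = kernel_const TYPE(real ^ 'n)"
  have C: "0 < C" by (simp add: C_def kernel_const_pos)
  \<comment> \<open>D \<rho> bounds (1 - s) times the kernel bound for directions of size \<rho>
    \<le> 1: the near part has (1 - s)/(2 - 2 s) = 1/2, the tail has (1 - s)/(2 s - 1) \<le> 1/(2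
    \<sigma> - 1), and \<rho>^2 \<le> \<rho>.\<close>
  define D where "D = C * (SC / 2 + 2 * L / (2 * \<sigma> - 1))"
  have D: "0 \<le> D" using C L SC \<sigma> by (simp add: D_def)
  \<comment> \<open>Gives D \<rho> \<le> 2 \<eta>; the denominator D + 1 covers D = 0. The
    eigenvalue threshold is (\<rho>/2)^2 because splitting doubles square roots.\<close>
  define \<rho> where "\<rho> = min 1 (2 * \<eta> / (D + 1))"
  have \<rho>: "0 < \<rho>" "\<rho> \<le> 1" using D \<eta> by (auto simp: \<rho>_def)
  have D\<rho>: "D * \<rho> \<le> 2 * \<eta>"
  proof -
    have "\<rho> \<le> 2 * \<eta> / (D + 1)" by (simp add: \<rho>_def)
    then have "(D + 1) * \<rho> \<le> 2 * \<eta>" using D by (simp add: field_simps)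
    then show ?thesis using \<rho> by (simp add: distrib_right)
  qed
  obtain \<theta> where \<theta>: "0 < \<theta>" and comp: "\<And>M :: real ^ 'n ^ 'n. M \<in> Mclass k \<Longrightarrow> lambda_min M < \<theta> \<Longrightarrow>
    \<exists>Q m m' V. orthogonal_matrix Q \<and> M = conjm Q (diag m) \<and> (\<forall>i. 0 < m $ i) \<and>
      conjm Q (diag m') \<in> Mclass k \<and> \<theta> \<le> lambda_min (conjm Q (diag m')) \<and> (\<forall>i. 0 < m' $ i) \<and>
      (\<forall>i\<in>V. 4 * m' $ i \<le> m $ i) \<and> (\<forall>i. i \<notin> V \<longrightarrow> m' $ i \<le> (\<rho> / 2)\<^sup>2)"
    using Mclass_comparison[OF k, of "(\<rho> / 2)\<^sup>2"] \<rho> by (auto simp del: power_divide)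
  show ?thesis
  proof (intro exI[of _ \<theta>] conjI \<theta> allI impI ballI)
    fix s and \<Omega> :: "(real ^ 'n) set" and u x
    assume H: "\<sigma> \<le> s \<and> s < 1 \<and> open \<Omega> \<and> convex_on UNIV u \<and> L-lipschitz_on UNIV u \<and> semi_concave SC u \<and>
      viscosity_ge (\<lambda>v x. ereal (1 - s) * frac_hess k s v x) \<Omega> u (\<lambda>x. \<eta>)" and x: "x \<in> \<Omega>"
    then have s: "1 / 2 < s" "s < 1" "\<sigma> \<le> s" using \<sigma> by auto
    have [measurable]: "u \<in> borel_measurable borel"
      using H by (intro borel_measurable_continuous_onI) (auto simp: semi_concave_def)
    have small: "(1 - s) * (C * (SC * \<rho>\<^sup>2 / (2 - 2 * s) + 2 * L * \<rho> / (2 * s - 1))) \<le> 2 * \<eta>"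
    proof -
      have "(1 - s) * (C * (SC * \<rho>\<^sup>2 / (2 - 2 * s) + 2 * L * \<rho> / (2 * s - 1))) =
          C * (SC * \<rho>\<^sup>2 * ((1 - s) / (2 - 2 * s)) + 2 * L * \<rho> * ((1 - s) / (2 * s - 1)))"
        by (simp add: algebra_simps)
      also have "(1 - s) / (2 - 2 * s) = 1 / 2" using s by (simp add: field_simps)
      also have "C * (SC * \<rho>\<^sup>2 * (1 / 2) + 2 * L * \<rho> * ((1 - s) / (2 * s - 1))) \<le>
          C * (SC * \<rho> * (1 / 2) + 2 * L * \<rho> * (1 / (2 * \<sigma> - 1)))"
      proof (intro mult_left_mono add_mono mult_right_mono)
        show "\<rho>\<^sup>2 \<le> \<rho>" using \<rho> by (simp add: power2_eq_square mult_left_le)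
        show "(1 - s) / (2 * s - 1) \<le> 1 / (2 * \<sigma> - 1)" using s \<sigma> by (intro frac_le) auto
      qed (use C L SC \<rho> in auto)
      also have "\<dots> = D * \<rho>" by (simp add: D_def algebra_simps)
      finally show ?thesis using D\<rho> by linarith
    qed
    show "frac_hess k s u x = frac_hess_theta k s \<theta> u x"
    proof (rule antisym)
      show "frac_hess k s u x \<le> frac_hess_theta k s \<theta> u x"
        unfolding frac_hess_def frac_hess_theta_def by (intro INF_superset_mono) auto
      show "frac_hess_theta k s \<theta> u x \<le> frac_hess k s u x"
        unfolding frac_hess_def
      proof (rule INF_greatest)
        fix M :: "real ^ 'n ^ 'n" assume M: "M \<in> Mclass k"
        show "frac_hess_theta k s \<theta> u x \<le> frac_lin s M u x"
        proof (cases "lambda_min M < \<theta>")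
          case False
          then show ?thesis using M unfolding frac_hess_theta_def by (intro INF_lower) auto
        next
          case True
          then obtain Q m m' V where Q: "orthogonal_matrix Q" and Mm: "M = conjm Q (diag m)"
            and m: "\<And>i. 0 < m $ i" and M': "conjm Q (diag m') \<in> Mclass k"
            and t: "\<theta> \<le> lambda_min (conjm Q (diag m'))" and m': "\<And>i. 0 < m' $ i"
            and V: "\<And>i. i \<in> V \<Longrightarrow> 4 * m' $ i \<le> m $ i" "\<And>i. i \<notin> V \<Longrightarrow> m' $ i \<le> (\<rho> / 2)\<^sup>2"
            using comp[OF M True] by blast
          have nonneg: "0 \<le> second_diff u x y" for y using H second_diff_nonneg by blast
          have "kernel_integral s (\<lambda>z. second_diff u x (Q *v z)) (\<chi> i. sqrt (m' $ i)) \<le>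
              kernel_integral s (\<lambda>z. second_diff u x (Q *v z)) (\<chi> i. sqrt (m $ i))"
            using H s x Q m m' V \<rho> M' small unfolding C_def
            by (intro kernel_integral_le_of_lower_bound[where \<rho> = \<rho> and \<eta> = \<eta> and V = V and L = L and SC = SC]
                viscosity_ge_pointwise[where \<Omega> = \<Omega> and SC = SC and k = k]) auto
          then have "frac_lin s (conjm Q (diag m')) u x \<le> frac_lin s M u x"
            unfolding Mm frac_lin_eq_kernel_integral[OF Q m \<open>u \<in> borel_measurable borel\<close> nonneg]
              frac_lin_eq_kernel_integral[OF Q m' \<open>u \<in> borel_measurable borel\<close> nonneg]
            by (intro ereal_mult_left_mono) (auto simp: less_eq_ennreal.rep_eq)
          moreover have "frac_hess_theta k s \<theta> u x \<le> frac_lin s (conjm Q (diag m')) u x"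
            unfolding frac_hess_theta_def using M' t by (intro INF_lower) auto
          ultimately show ?thesis by (rule order_trans[rotated])
        qed
      qed
    qed
  qed
qed

theorem theorem1p3:
  fixes k :: nat and \<eta>\<^sub>0 L SC :: real
  assumes "2 \<le> k" and "k \<le> CARD('n::finite)" and "0 < \<eta>\<^sub>0"
  shows "\<exists>\<theta> :: real \<Rightarrow> real.
    (\<forall>s. 1 / 2 < s \<and> s < 1 \<longrightarrow>
       0 < \<theta> s \<and>
       (\<forall>(\<Omega> :: (real ^ 'n) set) (u :: real ^ 'n \<Rightarrow> real).
          open \<Omega> \<and> convex_on UNIV u \<and> L-lipschitz_on UNIV u \<and> semi_concave SC u \<and>
          viscosity_ge (\<lambda>v x. ereal (1 - s) * frac_hess k s v x) \<Omega> u (\<lambda>x. \<eta>\<^sub>0) \<longrightarrow>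
          (\<forall>x\<in>\<Omega>. frac_hess k s u x = frac_hess_theta k s (\<theta> s) u x))) \<and>
    (\<exists>c>0. \<forall>\<^sub>F s in at_left 1. c \<le> \<theta> s)"
proof -
  have "\<forall>\<sigma>. \<exists>\<theta>. 1 / 2 < \<sigma> \<longrightarrow> 0 < \<theta> \<and> (\<forall>s (\<Omega> :: (real ^ 'n) set) u.
    \<sigma> \<le> s \<and> s < 1 \<and> open \<Omega> \<and> convex_on UNIV u \<and> L-lipschitz_on UNIV u \<and> semi_concave SC u \<and>
    viscosity_ge (\<lambda>v x. ereal (1 - s) * frac_hess k s v x) \<Omega> u (\<lambda>x. \<eta>\<^sub>0) \<longrightarrow>
    (\<forall>x\<in>\<Omega>. frac_hess k s u x = frac_hess_theta k s \<theta> u x))"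
    using frac_hess_eq_theta[OF assms] by blast
  then obtain T where T: "\<And>\<sigma>. 1 / 2 < \<sigma> \<Longrightarrow> 0 < T \<sigma> \<and> (\<forall>s (\<Omega> :: (real ^ 'n) set) u.
    \<sigma> \<le> s \<and> s < 1 \<and> open \<Omega> \<and> convex_on UNIV u \<and> L-lipschitz_on UNIV u \<and> semi_concave SC u \<and>
    viscosity_ge (\<lambda>v x. ereal (1 - s) * frac_hess k s v x) \<Omega> u (\<lambda>x. \<eta>\<^sub>0) \<longrightarrow>
    (\<forall>x\<in>\<Omega>. frac_hess k s u x = frac_hess_theta k s (T \<sigma>) u x))"
    by metis
  \<comment> \<open>Any number strictly between 1/2 and 1 could replace 3/4. Above it one value
    serves every s, so \<theta> is constant near 1; below it each s is its own lower bound
    \<sigma>.\<close>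
  let ?\<theta> = "\<lambda>s. if 3 / 4 \<le> s then T (3 / 4) else T s"
  have "\<forall>\<^sub>F s :: real in at_left 1. 3 / 4 \<le> s"
    using eventually_at_left_field[of "\<lambda>s. 3 / 4 \<le> s" 1] by (auto intro: exI[of _ "3 / 4"])
  then have "\<forall>\<^sub>F s in at_left 1. T (3 / 4) \<le> ?\<theta> s"
    by eventually_elim simp
  then have E: "\<exists>c>0. \<forall>\<^sub>F s in at_left 1. c \<le> ?\<theta> s"
    using T[of "3 / 4"] by (intro exI[of _ "T (3 / 4)"]) auto
  have A: "0 < ?\<theta> s \<and> (\<forall>(\<Omega> :: (real ^ 'n) set) u.
      open \<Omega> \<and> convex_on UNIV u \<and> L-lipschitz_on UNIV u \<and> semi_concave SC u \<and>
      viscosity_ge (\<lambda>v x. ereal (1 - s) * frac_hess k s v x) \<Omega> u (\<lambda>x. \<eta>\<^sub>0) \<longrightarrow>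
      (\<forall>x\<in>\<Omega>. frac_hess k s u x = frac_hess_theta k s (?\<theta> s) u x))" if s: "1 / 2 < s \<and> s < 1" for s
  proof -
    define \<sigma> where "\<sigma> = (if 3 / 4 \<le> s then 3 / 4 else s)"
    have "1 / 2 < \<sigma>" "\<sigma> \<le> s" using s by (auto simp: \<sigma>_def)
    moreover have "?\<theta> s = T \<sigma>" by (simp add: \<sigma>_def)
    ultimately show ?thesis using T[of \<sigma>] s by (simp only:) blast
  qed
  show ?thesis
    by (rule exI[of _ ?\<theta>], rule conjI, intro allI impI, rule A, assumption, rule E)
qed

end
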